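(* Let $K_0\subset\mathbb{R}$ be a fixed bounded interval. Suppose $\gamma$ is a curve in $\mathbb{S}^2$ that is $C^5$ on a neighborhood of $\{\theta h:\theta\in K_0\}$, and assume that all points generated by the SIDER2 constructions, and by the SIDER3 construction under consideration, remain in a common geodesically convex ball of radius $O(h)$. Then the SIDER3 reconstruction satisfies $$\operatorname{Log}_{\gamma(\theta h)}P_i^{[3]}(\theta;h)=-\frac{h^4}{72}\,\Pi_i^{[3]}(\theta)\,K(\theta)+O(h^5),$$ uniformly for $\theta$ in the bounded interval $K_0$, where $\Pi_i^{[3]}(\theta)=\prod_{j=i}^{i+3}(\theta-j)$ and $$K(\theta)=3D-4\left(|V|^2A-\langle V,A\rangle V\right)\in T_{\gamma(\theta h)}\mathbb{S}^2,$$ with $V=X'(0)$, $A=X''(0)$, $D=X^{(4)}(0)$ for $X(\eta)=\operatorname{Log}_{\gamma(\theta h)}\gamma(\theta h+\eta)$.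
   Context: $\mathbb{S}^2=\{x\in\mathbb{R}^3:|x|=1\}$ with the induced Riemannian metric. $\operatorname{Exp}_y(v)=\cos|v|\,y+\frac{\sin|v|}{|v|}v$ for $v\in T_y\mathbb{S}^2=\{v\in\mathbb{R}^3:v\cdot y=0\}$ (with $\operatorname{Exp}_y(0)=y$). For $z$ not antipodal to $y$ and $\alpha=\arccos(y\cdot z)$, $\operatorname{Log}_y(z)=\frac{\alpha}{\sin\alpha}(z-(y\cdot z)y)$ (with $\operatorname{Log}_y(y)=0$). For non-antipodal $a,b\in\mathbb{S}^2$ and any real $\lambda$, $\operatorname{SLERP}(a,b,\lambda)=\operatorname{Exp}_a(\lambda\operatorname{Log}_a b)$, equivalently $\frac{\sin((1-\lambda)\alpha)}{\sin\alpha}a+\frac{\sin(\lambda\alpha)}{\sin\alpha}b$ with $\alpha=\arccos(a\cdot b)\in(0,\pi)$. SIDER construction. Let $p_j=\gamma(jh)$. For a stencil beginning at index $i$, with $\tau=(\theta-i)/2$, $d_a=\operatorname{SLERP}(p_{i+2},p_{i+1},2)$, $d_b=\operatorname{SLERP}(p_i,p_{i+1},2)$, $$P_i^{[2]}(\theta;h)=\operatorname{SLERP}\bigl(\operatorname{SLERP}(p_i,d_a,\tau),\operatorname{SLERP}(d_b,p_{i+2},\tau),\tau\bigr),$$ and $P_i^{[3]}(\theta;h)=\operatorname{SLERP}\bigl(P_i^{[2]}(\theta;h),P_{i+1}^{[2]}(\theta;h),\frac{\theta-i}{3}\bigr)$. Normal-coordinate Taylor expansion: $X(\eta)=\eta V+\frac{\eta^2}{2}A+\frac{\eta^3}{6}B+\frac{\eta^4}{24}D+O(\eta^5)$.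 Conventions: $i$ is a fixed stencil index, $\gamma$ is a fixed curve and $h\to0^+$; $h$ is small enough that, in the common geodesically convex ball, logarithms are single-valued and geodesics unique. $O(h^5)$ means bounded in norm by $Ch^5$ for all sufficiently small $h$, with $C$ independent of $h$ and $\theta$. *)

theory Defs
  imports "HOL-Analysis.Analysis"
begin

subsection \<open>Exponential, logarithm and SLERP on the unit sphere\<close>

definition tangent_space_S2 :: "real^3 \<Rightarrow> (real^3) set" where
  "tangent_space_S2 y = {v. v \<bullet> y = 0}"

text \<open>Division by zero gives zero, so \<^term>\<open>v = 0\<close> yields \<^term>\<open>y\<close>.\<close>
definition sphere_exp :: "real^3 \<Rightarrow> real^3 \<Rightarrow> real^3" where
  "sphere_exp y v = cos (norm v) *\<^sub>R y + (sin (norm v) / norm v) *\<^sub>R v"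

text \<open>For unit vectors, \<^term>\<open>z = y\<close> yields \<^term>\<open>0\<close>, again by division by zero.
  The value at \<^term>\<open>z = - y\<close> is a meaningless zero.\<close>
definition sphere_log :: "real^3 \<Rightarrow> real^3 \<Rightarrow> real^3" where
  "sphere_log y z =
    (let \<alpha> = arccos (y \<bullet> z) in (\<alpha> / sin \<alpha>) *\<^sub>R (z - (y \<bullet> z) *\<^sub>R y))"

definition slerp :: "real^3 \<Rightarrow> real^3 \<Rightarrow> real \<Rightarrow> real^3" where
  "slerp a b s = sphere_exp a (s *\<^sub>R sphere_log a b)"

definition geodesic_ball :: "real^3 \<Rightarrow> real \<Rightarrow> (real^3) set" where
  "geodesic_ball c r = {x \<in> sphere 0 1. arccos (c \<bullet> x) < r}"

text \<open>Two points of the sphere are joined by a unique minimizing geodesic iff they are not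
  antipodal, and this geodesic is then \<^term>\<open>slerp a b\<close> on \<^term>\<open>{0..1::real}\<close>.\<close>
definition geodesically_convex :: "(real^3) set \<Rightarrow> bool" where
  "geodesically_convex S \<longleftrightarrow> S \<subseteq> sphere 0 1 \<and>
    (\<forall>a\<in>S. \<forall>b\<in>S. a \<noteq> - b \<and> (\<forall>s\<in>{0..1}. slerp a b s \<in> S))"

subsection \<open>SIDER reconstructions\<close>

definition node :: "(real \<Rightarrow> real^3) \<Rightarrow> real \<Rightarrow> int \<Rightarrow> real^3" where
  "node \<gamma> h j = \<gamma> (of_int j * h)"

definition sider_da :: "(real \<Rightarrow> real^3) \<Rightarrow> int \<Rightarrow> real \<Rightarrow> real^3" where
  "sider_da \<gamma> i h = slerp (node \<gamma> h (i + 2)) (node \<gamma> h (i + 1)) 2"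

definition sider_db :: "(real \<Rightarrow> real^3) \<Rightarrow> int \<Rightarrow> real \<Rightarrow> real^3" where
  "sider_db \<gamma> i h = slerp (node \<gamma> h i) (node \<gamma> h (i + 1)) 2"

definition sider_qa :: "(real \<Rightarrow> real^3) \<Rightarrow> int \<Rightarrow> real \<Rightarrow> real \<Rightarrow> real^3" where
  "sider_qa \<gamma> i \<theta> h = slerp (node \<gamma> h i) (sider_da \<gamma> i h) ((\<theta> - of_int i) / 2)"

definition sider_qb :: "(real \<Rightarrow> real^3) \<Rightarrow> int \<Rightarrow> real \<Rightarrow> real \<Rightarrow> real^3" where
  "sider_qb \<gamma> i \<theta> h = slerp (sider_db \<gamma> i h) (node \<gamma> h (i + 2)) ((\<theta> - of_int i) / 2)"

definition sider2 :: "(real \<Rightarrow> real^3) \<Rightarrow> int \<Rightarrow> real \<Rightarrow> real \<Rightarrow> real^3" where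
  "sider2 \<gamma> i \<theta> h = slerp (sider_qa \<gamma> i \<theta> h) (sider_qb \<gamma> i \<theta> h) ((\<theta> - of_int i) / 2)"

definition sider3 :: "(real \<Rightarrow> real^3) \<Rightarrow> int \<Rightarrow> real \<Rightarrow> real \<Rightarrow> real^3" where
  "sider3 \<gamma> i \<theta> h = slerp (sider2 \<gamma> i \<theta> h) (sider2 \<gamma> (i + 1) \<theta> h) ((\<theta> - of_int i) / 3)"

definition sider2_points :: "(real \<Rightarrow> real^3) \<Rightarrow> int \<Rightarrow> real \<Rightarrow> real \<Rightarrow> (real^3) set" where
  "sider2_points \<gamma> i \<theta> h =
    {node \<gamma> h i, node \<gamma> h (i + 1), node \<gamma> h (i + 2), sider_da \<gamma> i h, sider_db \<gamma> i h,
     sider_qa \<gamma> i \<theta> h, sider_qb \<gamma> i \<theta> h, sider2 \<gamma> i \<theta> h}"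

definition sider3_points :: "(real \<Rightarrow> real^3) \<Rightarrow> int \<Rightarrow> real \<Rightarrow> real \<Rightarrow> (real^3) set" where
  "sider3_points \<gamma> i \<theta> h =
    sider2_points \<gamma> i \<theta> h \<union> sider2_points \<gamma> (i + 1) \<theta> h \<union> {sider3 \<gamma> i \<theta> h}"

subsection \<open>Regularity and the leading coefficient\<close>

definition nth_vector_derivative ::
    "nat \<Rightarrow> (real \<Rightarrow> 'a::real_normed_vector) \<Rightarrow> real \<Rightarrow> 'a" where
  "nth_vector_derivative n f = ((\<lambda>g t. vector_derivative g (at t)) ^^ n) f"

text \<open>Meant for open \<^term>\<open>S\<close>, since the derivatives are two-sided.\<close>
definition Ck_on :: "nat \<Rightarrow> (real \<Rightarrow> 'a::real_normed_vector) \<Rightarrow> real set \<Rightarrow> bool" where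
  "Ck_on k f S \<longleftrightarrow>
    (\<forall>j<k. \<forall>t\<in>S. nth_vector_derivative j f differentiable (at t)) \<and>
    continuous_on S (nth_vector_derivative k f)"

definition normal_coord :: "(real \<Rightarrow> real^3) \<Rightarrow> real \<Rightarrow> real \<Rightarrow> real^3" where
  "normal_coord \<gamma> t \<eta> = sphere_log (\<gamma> t) (\<gamma> (t + \<eta>))"

definition sider3_coeff :: "(real \<Rightarrow> real^3) \<Rightarrow> real \<Rightarrow> real^3" where
  "sider3_coeff \<gamma> t =
    (let V = nth_vector_derivative 1 (normal_coord \<gamma> t) 0;
         A = nth_vector_derivative 2 (normal_coord \<gamma> t) 0;
         D = nth_vector_derivative 4 (normal_coord \<gamma> t) 0
     in 3 *\<^sub>R D - 4 *\<^sub>R ((norm V)\<^sup>2 *\<^sub>R A - (V \<bullet> A) *\<^sub>R V))"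

end

theory Submission
  imports Defs
begin

text \<open>
  Write $y = \gamma(\theta h)$ and describe a nearby point $z$ of the sphere by its orthogonal
  projection $p = z - (y \cdot z) y$ to the tangent plane at $y$. Since SLERP is a linear
  combination of its end points, with weights $\sin((1-s)\alpha)/\sin\alpha$ and
  $\sin(s\alpha)/\sin\alpha$, it becomes in these coordinates
  $$(p, q, s) \mapsto (1-s)p + sq + \frac{s(1-s)}{6} |p-q|^2 ((2-s)p + (1+s)q) + O(h^5).$$
  The $O(h^4)$ errors of the two weights multiply $p$ and $q$, which are $O(h)$.

  If $V$, $A$, $B$, $E$ are the projections of the first four derivatives of $\gamma$ at
  $\theta h$, all points of the construction therefore have an expansion in the seven vectors
  $hV$, $h^2A$, $h^3B$, $h^4E$, $h^3|V|^2V$, $h^4|V|^2A$, $h^4\langle V,A\rangle V$, whose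
  coefficients are polynomials in $\theta - i$. For SIDER3 only
  $-\frac{h^4}{72}\Pi\,(3E + 2|V|^2A + 16\langle V,A\rangle V)$ survives, and so the
  logarithm agrees with the projection up to $O(h^5)$.

  Finally $\mathrm{Log}_y z = F(1 - y \cdot z)\,p$ with $F$ analytic, $F(0) = 1$ and
  $F'(0) = 1/3$. Differentiating this along $\gamma$ shows that $V$ and $A$ are also the
  derivatives of the normal coordinate and that its fourth derivative is
  $D = E + 2|V|^2A + 4\langle V,A\rangle V$, which turns the bracket into $K$.
\<close>

subsection \<open>SLERP in orthographic coordinates\<close>

definition tproj :: "'a::real_inner \<Rightarrow> 'a \<Rightarrow> 'a" where
  "tproj y z = z - (y \<bullet> z) *\<^sub>R y"

lemma sphere_log_tproj:
  "sphere_log y z = (arccos (y \<bullet> z) / sin (arccos (y \<bullet> z))) *\<^sub>R tproj y z"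
  by (simp add: sphere_log_def tproj_def Let_def)

lemma bounded_linear_tproj: "bounded_linear (tproj y)"
  unfolding tproj_def
  by (intro bounded_linear_sub bounded_linear_ident bounded_linear_scaleR_const bounded_linear_inner_right)

lemma tproj_add: "tproj y (a + b) = tproj y a + tproj y b"
  and tproj_diff: "tproj y (a - b) = tproj y a - tproj y b"
  and tproj_scaleR: "tproj y (c *\<^sub>R a) = c *\<^sub>R tproj y a"
  by (simp_all add: tproj_def inner_add_right inner_diff_right algebra_simps)

lemma tproj_self: "norm y = 1 \<Longrightarrow> tproj y y = 0"
  by (simp add: tproj_def dot_square_norm)

lemma tproj_inner_base: "norm y = 1 \<Longrightarrow> tproj y z \<bullet> y = 0"
  unfolding inner_commute[of _ y] by (simp add: tproj_def inner_diff_right dot_square_norm)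

lemma norm_tproj_sq:
  assumes "norm y = 1"
  shows "(norm (tproj y z))\<^sup>2 = (norm z)\<^sup>2 - (y \<bullet> z)\<^sup>2"
proof -
  have "y \<bullet> y = 1" using assms by (simp add: dot_square_norm)
  then show ?thesis
    unfolding power2_norm_eq_inner tproj_def
    by (simp add: inner_diff_left inner_diff_right inner_commute power2_eq_square)
qed

lemma norm_tproj_le:
  assumes "norm y = 1"
  shows "norm (tproj y z) \<le> norm z"
  by (rule power2_le_imp_le) (simp_all add: norm_tproj_sq[OF assms])

lemma norm_tproj_le_dist:
  assumes "norm y = 1"
  shows "norm (tproj y z) \<le> norm (z - y)"
  using norm_tproj_le[OF assms, of "z - y"] tproj_self[OF assms] by (simp add: tproj_diff)

lemma unit_inner_eq:
  fixes a b :: "'a::real_inner"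
  assumes "norm a = 1" "norm b = 1"
  shows "a \<bullet> b = 1 - (norm (a - b))\<^sup>2 / 2"
proof -
  have "a \<bullet> a = 1" "b \<bullet> b = 1" using assms by (simp_all add: dot_square_norm)
  then show ?thesis
    unfolding power2_norm_eq_inner by (simp add: inner_diff_left inner_diff_right inner_commute field_simps)
qed

lemma unit_inner_bounds:
  fixes a b :: "'a::real_inner"
  assumes "norm a = 1" "norm b = 1"
  shows "-1 \<le> a \<bullet> b" "a \<bullet> b \<le> 1"
  using Cauchy_Schwarz_ineq2[of a b] assms by auto

lemma norm_sphere_exp:
  assumes "norm a = 1" "v \<bullet> a = 0"
  shows "norm (sphere_exp a v) = 1"
proof -
  have aa: "a \<bullet> a = 1" "a \<bullet> v = 0" using assms by (simp_all add: dot_square_norm inner_commute)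
  have "(norm (c *\<^sub>R a + k *\<^sub>R v))\<^sup>2 = c\<^sup>2 + k\<^sup>2 * (norm v)\<^sup>2" for c k
    unfolding power2_norm_eq_inner
    using aa assms(2) by (simp add: inner_add_left inner_add_right power2_eq_square)
  then have "(norm (sphere_exp a v))\<^sup>2 = (cos (norm v))\<^sup>2 + (sin (norm v) / norm v)\<^sup>2 * (norm v)\<^sup>2"
    unfolding sphere_exp_def by simp
  also have "\<dots> = 1"
    by (cases "v = 0") (simp_all add: power_divide)
  finally show ?thesis
    by (simp add: power2_eq_1_iff) (smt (verit) norm_ge_zero)
qed

lemma norm_slerp:
  assumes "norm a = 1"
  shows "norm (slerp a b s) = 1"
  unfolding slerp_def
  by (rule norm_sphere_exp[OF assms]) (simp add: sphere_log_tproj tproj_inner_base[OF assms])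

lemma sphere_log_self: "norm y = 1 \<Longrightarrow> sphere_log y y = 0"
  by (simp add: sphere_log_tproj tproj_self)

lemma slerp_same: "norm a = 1 \<Longrightarrow> slerp a a s = a"
  by (simp add: slerp_def sphere_exp_def sphere_log_self)

lemma slerp_trig:
  fixes a b :: "real^3"
  assumes a: "norm a = 1" and b: "norm b = 1"
    and \<alpha>: "a \<bullet> b = cos \<alpha>" "0 < \<alpha>" "\<alpha> < pi"
  shows "slerp a b s = (sin ((1 - s) * \<alpha>) / sin \<alpha>) *\<^sub>R a + (sin (s * \<alpha>) / sin \<alpha>) *\<^sub>R b"
    and "a \<bullet> slerp a b s = cos (s * \<alpha>)"
proof -
  have sp: "sin \<alpha> > 0" using \<alpha> by (simp add: sin_gt_zero)
  have ac: "arccos (a \<bullet> b) = \<alpha>" using \<alpha> by (simp add: arccos_cos)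
  have "(norm (tproj a b))\<^sup>2 = (sin \<alpha>)\<^sup>2"
    using norm_tproj_sq[OF a, of b] b \<alpha>(1) by (simp add: sin_squared_eq)
  then have nt: "norm (tproj a b) = sin \<alpha>"
    using sp by (simp add: power2_eq_iff_nonneg)
  define v where "v = s *\<^sub>R sphere_log a b"
  have v: "v = (s * \<alpha> / sin \<alpha>) *\<^sub>R tproj a b"
    unfolding v_def sphere_log_tproj ac by simp
  have nv: "norm v = \<bar>s * \<alpha>\<bar>"
    unfolding v using nt sp by (simp add: abs_mult)
  \<comment> \<open>The function sin x / x is even, so taking the norm loses nothing when
    \<open>s\<close> is negative; at 0 both sides are 0 by the convention for division by
    zero.\<close>
  have sc: "sin \<bar>x\<bar> / \<bar>x\<bar> = sin x / x" for x :: real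
    by (simp add: abs_if)
  have "slerp a b s = cos (s * \<alpha>) *\<^sub>R a + (sin (s * \<alpha>) / (s * \<alpha>)) *\<^sub>R v"
    unfolding slerp_def v_def[symmetric] sphere_exp_def nv sc by simp
  also have "(sin (s * \<alpha>) / (s * \<alpha>)) *\<^sub>R v = (sin (s * \<alpha>) / sin \<alpha>) *\<^sub>R tproj a b"
    unfolding v using \<alpha>(2) by (cases "s = 0") simp_all
  finally have sl: "slerp a b s = cos (s * \<alpha>) *\<^sub>R a + (sin (s * \<alpha>) / sin \<alpha>) *\<^sub>R tproj a b" .
  have "sin ((1 - s) * \<alpha>) / sin \<alpha> = cos (s * \<alpha>) - sin (s * \<alpha>) / sin \<alpha> * cos \<alpha>"
    using sp by (simp add: left_diff_distrib sin_diff field_simps)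
  then show "slerp a b s = (sin ((1 - s) * \<alpha>) / sin \<alpha>) *\<^sub>R a + (sin (s * \<alpha>) / sin \<alpha>) *\<^sub>R b"
    unfolding sl tproj_def \<alpha>(1)
    by (simp only: scaleR_diff_left scaleR_diff_right scaleR_scaleR) simp
  show "a \<bullet> slerp a b s = cos (s * \<alpha>)"
    unfolding sl using tproj_inner_base[OF a, of b] a
    by (simp add: inner_add_right inner_commute dot_square_norm)
qed

section \<open>Quantitative expansion of the SLERP weights\<close>

lemma sin_taylor5: "\<bar>sin x - (x - x ^ 3 / 6)\<bar> \<le> \<bar>x\<bar> ^ 5 / 120" for x :: real
proof -
  have "\<bar>sin x - (\<Sum>m<5. sin_coeff m * x ^ m)\<bar> \<le> inverse (fact 5) * \<bar>x\<bar> ^ 5"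
    by (rule Maclaurin_sin_bound)
  moreover have "{..<5} = {0, 1, 2, 3, 4::nat}" by auto
  then have "(\<Sum>m<5. sin_coeff m * x ^ m) = x - x ^ 3 / 6"
    by (simp add: sin_coeff_def fact_numeral)
  ultimately show ?thesis
    by (simp add: fact_numeral eval_nat_numeral)
qed

lemma cos_taylor4:
  fixes x :: real
  shows "1 - x\<^sup>2 / 2 \<le> cos x" "cos x \<le> 1 - x\<^sup>2 / 2 + x ^ 4 / 24"
proof -
  obtain t where t: "cos x = (\<Sum>m<4. cos_coeff m * x ^ m) + cos (t + 1/2 * real 4 * pi) / fact 4 * x ^ 4"
    using Maclaurin_cos_expansion[of x 4] by blast
  have "{..<4} = {0, 1, 2, 3::nat}" by auto
  then have "(\<Sum>m<4. cos_coeff m * x ^ m) = 1 - x\<^sup>2 / 2"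
    by (simp add: cos_coeff_def fact_numeral)
  moreover have "cos (t + 1/2 * real 4 * pi) / fact 4 * x ^ 4 \<le> 1 / 24 * x ^ 4"
    by (rule mult_right_mono) (simp_all add: fact_numeral divide_simps)
  ultimately show "cos x \<le> 1 - x\<^sup>2 / 2 + x ^ 4 / 24" using t by simp
  \<comment> \<open>Half-angle formula: cos x = 1 - 2 sin(x/2)^2.\<close>
  show "1 - x\<^sup>2 / 2 \<le> cos x"
    using cos_ge_minus_one[of x] abs_sin_x_le_abs_x[of "x/2"] cos_double_sin[of "x/2"]
      power_mono[of "\<bar>sin (x/2)\<bar>" "\<bar>x/2\<bar>" 2]
    by (simp add: power_divide)
qed

text \<open>The polynomial is six times the second-order coefficient of
  \<open>sin (u * \<alpha>) / sin \<alpha>\<close>. The fifth power is chosen because the same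
  majorant also covers the factor \<open>\<bar>u\<bar> ^ 5\<close> in the sine remainder.\<close>

lemma cubic_weight_bound: "\<bar>u * (1 - u\<^sup>2)\<bar> \<le> (1 + \<bar>u\<bar>) ^ 5" for u :: real
proof -
  have "\<bar>u * (1 - u\<^sup>2)\<bar> \<le> \<bar>u\<bar> * (1 + \<bar>u\<bar>\<^sup>2)"
    unfolding abs_mult by (rule mult_left_mono) (use abs_triangle_ineq4[of 1 "u\<^sup>2"] in auto)
  also have "\<dots> \<le> (1 + \<bar>u\<bar>) * (1 + \<bar>u\<bar>)\<^sup>2"
    by (intro mult_mono) (auto simp: power2_sum)
  also have "\<dots> = (1 + \<bar>u\<bar>) ^ 3" by (simp add: eval_nat_numeral)
  also have "\<dots> \<le> (1 + \<bar>u\<bar>) ^ 5" by (intro power_increasing) auto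
  finally show ?thesis .
qed

text \<open>Multiplied by \<open>sin \<alpha>\<close>, the approximation error is of fifth order,
  because the third-order terms cancel; dividing by \<open>sin \<alpha>\<close>, which is comparable
  to \<alpha>, loses one order. The dependence on \<open>s\<close> stays explicit so that it can
  later be made uniform in \<theta>.\<close>

lemma sin_ratio_bound:
  fixes s \<alpha> :: real
  assumes "0 < \<alpha>" "\<alpha> \<le> 1"
  shows "\<bar>sin (s * \<alpha>) / sin \<alpha> - (s + s * (1 - s\<^sup>2) / 6 * \<alpha>\<^sup>2)\<bar> \<le> (1 + \<bar>s\<bar>) ^ 5 * \<alpha> ^ 4"
proof -
  define E where "E = (1 + \<bar>s\<bar>) ^ 5"
  define W where "W = s + s * (1 - s\<^sup>2) / 6 * \<alpha>\<^sup>2"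
  have E: "\<bar>s\<bar> ^ 5 \<le> E"
    unfolding E_def by (intro power_mono) auto
  have sc: "\<bar>s * (1 - s\<^sup>2)\<bar> \<le> E" unfolding E_def by (rule cubic_weight_bound)
  have sE: "\<bar>s\<bar> \<le> E"
    unfolding E_def using power_increasing[of 1 5 "1 + \<bar>s\<bar>"] by simp
  have a3: "\<alpha> ^ 3 \<le> \<alpha>" and a2: "\<alpha>\<^sup>2 \<le> 1"
    using assms power_decreasing[of 1 3 \<alpha>] power_le_one[of \<alpha> 2] by auto
  have W: "\<bar>W\<bar> \<le> 7 / 6 * E"
  proof -
    have "\<bar>s * (1 - s\<^sup>2) / 6 * \<alpha>\<^sup>2\<bar> = \<bar>s * (1 - s\<^sup>2)\<bar> * \<alpha>\<^sup>2 / 6" by (simp add: abs_mult)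
    also have "\<dots> \<le> E * 1 / 6" using sc a2 by (intro divide_right_mono mult_mono) auto
    finally show ?thesis unfolding W_def using sE by linarith
  qed
  \<comment> \<open>For 0 < \<alpha> \<le> 1, \<alpha> - \<alpha>^3/6 - \<alpha>^5/120 is at least
    99/120 of \<alpha>.\<close>
  have sl: "sin \<alpha> \<ge> 4 / 5 * \<alpha>"
    using sin_taylor5[of \<alpha>] a3 assms power_decreasing[of 1 5 \<alpha>]
    unfolding abs_le_iff by (simp add: field_simps)
  \<comment> \<open>The first two terms carry the sine remainders; the last is what is left of the
    truncated expressions once the terms of order 1 and 3 have cancelled.\<close>
  have eq: "sin (s * \<alpha>) - sin \<alpha> * W =
      (sin (s * \<alpha>) - (s * \<alpha> - (s * \<alpha>) ^ 3 / 6)) - (sin \<alpha> - (\<alpha> - \<alpha> ^ 3 / 6)) * W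
      + s * (1 - s\<^sup>2) / 36 * \<alpha> ^ 5"
    unfolding W_def by (simp add: field_simps eval_nat_numeral)
  define Z where "Z = E * \<alpha> ^ 5"
  have "\<bar>s * \<alpha>\<bar> ^ 5 \<le> Z"
    using mult_right_mono[OF E, of "\<alpha> ^ 5"] assms by (simp add: Z_def abs_mult power_mult_distrib)
  then have "\<bar>sin (s * \<alpha>) - (s * \<alpha> - (s * \<alpha>) ^ 3 / 6)\<bar> \<le> Z / 120"
    using sin_taylor5[of "s * \<alpha>"] by linarith
  moreover have "\<bar>(sin \<alpha> - (\<alpha> - \<alpha> ^ 3 / 6)) * W\<bar> \<le> 7 / 720 * Z"
  proof -
    have "\<bar>(sin \<alpha> - (\<alpha> - \<alpha> ^ 3 / 6)) * W\<bar> \<le> \<alpha> ^ 5 / 120 * (7 / 6 * E)"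
      unfolding abs_mult using sin_taylor5[of \<alpha>] W assms by (intro mult_mono) auto
    then show ?thesis by (simp add: Z_def mult_ac)
  qed
  moreover have "\<bar>s * (1 - s\<^sup>2) / 36 * \<alpha> ^ 5\<bar> \<le> Z / 36"
    using mult_right_mono[OF sc, of "\<alpha> ^ 5"] assms by (simp add: Z_def abs_mult)
  moreover have "0 \<le> Z" using E assms by (simp add: Z_def E_def)
  \<comment> \<open>The three bounds add up to 33/720 of \<open>Z\<close>, far below 4/5; this
    constant is taken to match the lower bound on \<open>sin \<alpha>\<close>.\<close>
  moreover have "\<bar>x - y + z\<bar> \<le> 4 / 5 * Z"
    if "\<bar>x\<bar> \<le> Z / 120" "\<bar>y\<bar> \<le> 7 / 720 * Z" "\<bar>z\<bar> \<le> Z / 36" "0 \<le> Z" for x y z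
    using that by linarith
  ultimately have "\<bar>sin (s * \<alpha>) - sin \<alpha> * W\<bar> \<le> 4 / 5 * (E * \<alpha> ^ 5)"
    unfolding eq Z_def[symmetric] by metis
  also have "\<dots> = 4 / 5 * \<alpha> * (E * \<alpha> ^ 4)" by (simp add: eval_nat_numeral)
  also have "\<dots> \<le> sin \<alpha> * (E * \<alpha> ^ 4)"
    using sl by (rule mult_right_mono) (simp add: E_def)
  finally have m: "\<bar>sin (s * \<alpha>) - sin \<alpha> * W\<bar> \<le> sin \<alpha> * (E * \<alpha> ^ 4)" .
  have sp: "sin \<alpha> > 0" using sl assms by simp
  have "\<bar>sin (s * \<alpha>) / sin \<alpha> - W\<bar> = \<bar>sin (s * \<alpha>) - sin \<alpha> * W\<bar> / sin \<alpha>"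
  proof -
    have "sin (s * \<alpha>) / sin \<alpha> - W = (sin (s * \<alpha>) - sin \<alpha> * W) / sin \<alpha>"
      using sp by (simp add: diff_divide_distrib)
    then show ?thesis using sp by simp
  qed
  also have "\<dots> \<le> E * \<alpha> ^ 4"
    using m sp by (simp add: divide_simps mult_ac)
  finally show ?thesis unfolding W_def E_def .
qed

text \<open>The squared chord is 2 - 2 cos \<alpha>, so by the bounds on the cosine it differs from
  \<alpha>^2 only at fourth order. This allows the angle to be replaced by the chord, whose square
  is a polynomial in the points.\<close>

lemma small_angle:
  fixes a b :: "real^3"
  assumes a: "norm a = 1" and b: "norm b = 1" and ab: "a \<noteq> b" and d: "norm (a - b) \<le> 1 / 2"
  obtains \<alpha> where "a \<bullet> b = cos \<alpha>" "0 < \<alpha>" "\<alpha> \<le> 1" "\<alpha>\<^sup>2 \<le> 2 * (norm (a - b))\<^sup>2"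
    "\<bar>\<alpha>\<^sup>2 - (norm (a - b))\<^sup>2\<bar> \<le> \<alpha> ^ 4 / 12"
proof -
  define d where "d = norm (a - b)"
  define \<alpha> where "\<alpha> = arccos (a \<bullet> b)"
  have inn: "a \<bullet> b = 1 - d\<^sup>2 / 2" unfolding d_def by (rule unit_inner_eq[OF a b])
  have d0: "d > 0" "d\<^sup>2 \<le> 1 / 4"
    using ab assms(4) power_mono[of d "1/2" 2] by (auto simp: d_def power_divide)
  have c: "cos \<alpha> = a \<bullet> b" unfolding \<alpha>_def using unit_inner_bounds[OF a b] by simp
  have "\<alpha> \<noteq> 0" using c inn d0 by auto
  then have p: "0 < \<alpha>" "\<alpha> \<le> pi"
    unfolding \<alpha>_def using unit_inner_bounds[OF a b] arccos_lbound[of "a \<bullet> b"] arccos_ubound[of "a \<bullet> b"]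
    by auto
  \<comment> \<open>cos 1 is at most 13/24, whereas cos \<alpha> = 1 - d^2/2 is at least
    7/8.\<close>
  have "cos \<alpha> \<ge> cos 1"
    using cos_taylor4(2)[of 1] d0(2) by (simp add: c inn)
  then have le1: "\<alpha> \<le> 1"
    using p pi_gt3 cos_mono_le_eq[of 1 \<alpha>] by auto
  have b1: "d\<^sup>2 \<le> \<alpha>\<^sup>2" "\<alpha>\<^sup>2 - \<alpha> ^ 4 / 12 \<le> d\<^sup>2"
    using cos_taylor4[of \<alpha>] unfolding c inn by auto
  have "\<alpha> ^ 4 = \<alpha>\<^sup>2 * \<alpha>\<^sup>2" by (simp add: eval_nat_numeral)
  also have "\<dots> \<le> 1 * \<alpha>\<^sup>2" using le1 p power_le_one[of \<alpha> 2] by (intro mult_right_mono) auto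
  finally have "\<alpha>\<^sup>2 \<le> 2 * d\<^sup>2" using b1 by simp
  then show ?thesis using that[of \<alpha>] c p le1 b1 by (auto simp: d_def)
qed

text \<open>Both weights are the ratio of \<open>sin_ratio_bound\<close>, taken at
  \<open>1 - s\<close> and at \<open>s\<close>, with \<alpha>^2 replaced by the squared chord.
  Coincident end points, where the ratio of sines has no meaning, are covered by the weights
  \<open>1 - s\<close> and \<open>s\<close> with error 0.\<close>

lemma slerp_weights:
  fixes a b :: "real^3"
  assumes a: "norm a = 1" and b: "norm b = 1" and d: "norm (a - b) \<le> 1 / 2"
  obtains w1 w2 where "slerp a b s = w1 *\<^sub>R a + w2 *\<^sub>R b"
    "\<bar>w1 - ((1 - s) + s * (1 - s) * (2 - s) / 6 * (norm (a - b))\<^sup>2)\<bar>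
       \<le> 8 * (1 + \<bar>1 - s\<bar>) ^ 5 * norm (a - b) ^ 4"
    "\<bar>w2 - (s + s * (1 - s) * (1 + s) / 6 * (norm (a - b))\<^sup>2)\<bar>
       \<le> 8 * (1 + \<bar>s\<bar>) ^ 5 * norm (a - b) ^ 4"
proof (cases "a = b")
  case True
  then show ?thesis
    using that[of "1 - s" s] slerp_same[OF a, of s] by (simp add: algebra_simps)
next
  case False
  define d where "d = norm (a - b)"
  obtain \<alpha> where \<alpha>: "a \<bullet> b = cos \<alpha>" "0 < \<alpha>" "\<alpha> \<le> 1" "\<alpha>\<^sup>2 \<le> 2 * d\<^sup>2" "\<bar>\<alpha>\<^sup>2 - d\<^sup>2\<bar> \<le> \<alpha> ^ 4 / 12"
    using small_angle[OF a b False assms(3)] unfolding d_def by metis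
  have "\<alpha> ^ 4 = (\<alpha>\<^sup>2)\<^sup>2" "d ^ 4 = (d\<^sup>2)\<^sup>2" by (simp_all add: eval_nat_numeral)
  then have a4: "\<alpha> ^ 4 \<le> 4 * d ^ 4"
    using power_mono[OF \<alpha>(4), of 2] by (simp add: power_mult_distrib)
  \<comment> \<open>The constant is 2 * 4: there are two errors of size
    \<open>E * \<alpha> ^ 4\<close>, and \<open>\<alpha> ^ 4 \<le> 4 * d ^ 4\<close>.\<close>
  have key: "\<bar>sin (u * \<alpha>) / sin \<alpha> - (u + u * (1 - u\<^sup>2) / 6 * d\<^sup>2)\<bar> \<le> 8 * (1 + \<bar>u\<bar>) ^ 5 * d ^ 4" for u
  proof -
    define E where "E = (1 + \<bar>u\<bar>) ^ 5"
    have E: "\<bar>u * (1 - u\<^sup>2)\<bar> \<le> E" unfolding E_def by (rule cubic_weight_bound)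
    then have E0: "E \<ge> 0" by simp
    define k where "k = u * (1 - u\<^sup>2) / 6"
    have "\<bar>k * \<alpha>\<^sup>2 - k * d\<^sup>2\<bar> = \<bar>k\<bar> * \<bar>\<alpha>\<^sup>2 - d\<^sup>2\<bar>"
      by (simp flip: abs_mult right_diff_distrib)
    also have "\<dots> \<le> E / 6 * (\<alpha> ^ 4 / 12)"
      using E \<alpha>(5) E0 by (intro mult_mono) (auto simp: k_def)
    also have "\<dots> \<le> E * \<alpha> ^ 4"
      using mult_nonneg_nonneg[OF E0, of "\<alpha> ^ 4"] by simp
    finally have "\<bar>k * \<alpha>\<^sup>2 - k * d\<^sup>2\<bar> \<le> E * \<alpha> ^ 4" .
    moreover have "\<bar>sin (u * \<alpha>) / sin \<alpha> - (u + k * \<alpha>\<^sup>2)\<bar> \<le> E * \<alpha> ^ 4"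
      using sin_ratio_bound[OF \<alpha>(2,3), of u] unfolding E_def k_def .
    ultimately have "\<bar>sin (u * \<alpha>) / sin \<alpha> - (u + k * d\<^sup>2)\<bar> \<le> E * \<alpha> ^ 4 + E * \<alpha> ^ 4"
      using abs_triangle_ineq[of "sin (u * \<alpha>) / sin \<alpha> - (u + k * \<alpha>\<^sup>2)" "k * \<alpha>\<^sup>2 - k * d\<^sup>2"]
      by simp
    also have "\<dots> \<le> 2 * (E * \<alpha> ^ 4)" using E0 by simp
    also have "\<dots> \<le> 2 * (E * (4 * d ^ 4))" using a4 E0 by (intro mult_left_mono) auto
    finally show ?thesis unfolding E_def k_def by simp
  qed
  have "(1 - s) * (1 - (1 - s)\<^sup>2) = s * (1 - s) * (2 - s)" "s * (1 - s\<^sup>2) = s * (1 - s) * (1 + s)"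
    by (simp_all add: power2_eq_square algebra_simps)
  with key[of s] key[of "1 - s"] show ?thesis
    using slerp_trig(1)[OF a b \<alpha>(1,2)] \<alpha>(3) pi_gt3
    by (intro that[of "sin ((1 - s) * \<alpha>) / sin \<alpha>" "sin (s * \<alpha>) / sin \<alpha>"])
      (simp_all flip: d_def)
qed

section \<open>The cubic model of SLERP in the tangent plane\<close>

definition slerp_jet :: "'a::real_inner \<Rightarrow> 'a \<Rightarrow> real \<Rightarrow> 'a" where
  "slerp_jet p q s = (1 - s) *\<^sub>R p + s *\<^sub>R q
     + (s * (1 - s) / 6 * (norm (p - q))\<^sup>2) *\<^sub>R ((2 - s) *\<^sub>R p + (1 + s) *\<^sub>R q)"

text \<open>Three errors occur: the fourth-order errors of the two weights, each multiplied by a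
  projection of size at most \<open>r\<close>, and the replacement of the chord by its projection.
  The latter changes the squared length by the square of the normal component, hence at fourth
  order, and is again multiplied by vectors of order \<open>r\<close>.\<close>

lemma tproj_slerp_bound:
  fixes a b y :: "real^3"
  assumes a: "norm a = 1" and b: "norm b = 1" and y: "norm y = 1"
    and ra: "norm (a - y) \<le> r" and rb: "norm (b - y) \<le> r" and r: "r \<le> 1 / 4"
  shows "norm (tproj y (slerp a b s) - slerp_jet (tproj y a) (tproj y b) s) \<le> 300 * (2 + \<bar>s\<bar>) ^ 5 * r ^ 5"
proof -
  define d where "d = norm (a - b)"
  define p q where "p = tproj y a" and "q = tproj y b"
  define E where "E = (2 + \<bar>s\<bar>) ^ 5"
  have r0: "0 \<le> r" using ra norm_ge_zero[of "a - y"] by linarith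
  have d2: "d \<le> 2 * r"
    using norm_triangle_ineq4[of "a - y" "b - y"] ra rb unfolding d_def by simp
  then have "norm (a - b) \<le> 1/2" using r d_def by simp
  then obtain w1 w2 where w: "slerp a b s = w1 *\<^sub>R a + w2 *\<^sub>R b"
    "\<bar>w1 - ((1 - s) + s * (1 - s) * (2 - s) / 6 * d\<^sup>2)\<bar> \<le> 8 * (1 + \<bar>1 - s\<bar>) ^ 5 * d ^ 4"
    "\<bar>w2 - (s + s * (1 - s) * (1 + s) / 6 * d\<^sup>2)\<bar> \<le> 8 * (1 + \<bar>s\<bar>) ^ 5 * d ^ 4"
    using slerp_weights[OF a b] unfolding d_def by metis
  define e1 where "e1 = w1 - ((1 - s) + s * (1 - s) * (2 - s) / 6 * d\<^sup>2)"
  define e2 where "e2 = w2 - (s + s * (1 - s) * (1 + s) / 6 * d\<^sup>2)"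
  have d4: "d ^ 4 \<le> 16 * r ^ 4"
    using power_mono[OF d2, of 4] by (simp add: d_def power_mult_distrib)
  have e1: "\<bar>e1\<bar> \<le> 8 * E * (16 * r ^ 4)"
    using w(2) d4 unfolding e1_def[symmetric] E_def
    by (elim order_trans, intro mult_mono power_mono) (auto simp: d_def)
  have e2: "\<bar>e2\<bar> \<le> 8 * E * (16 * r ^ 4)"
    using w(3) d4 unfolding e2_def[symmetric] E_def
    by (elim order_trans, intro mult_mono power_mono) (auto simp: d_def)
  have p: "norm p \<le> r" and q: "norm q \<le> r"
    using norm_tproj_le_dist[OF y, of a] norm_tproj_le_dist[OF y, of b] ra rb p_def q_def by auto
  have "(norm (p - q))\<^sup>2 = d\<^sup>2 - (y \<bullet> (a - b))\<^sup>2"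
    using norm_tproj_sq[OF y, of "a - b"] by (simp add: p_def q_def d_def tproj_diff)
  \<comment> \<open>The component of a unit vector along \<open>y\<close> is 1 minus half its
    squared distance to \<open>y\<close>, so the two components differ by a quantity quadratic in
    \<open>r\<close>.\<close>
  moreover have "\<bar>y \<bullet> (a - b)\<bar> \<le> r\<^sup>2"
  proof -
    have "y \<bullet> (a - b) = ((norm (b - y))\<^sup>2 - (norm (a - y))\<^sup>2) / 2"
      using unit_inner_eq[OF a y] unit_inner_eq[OF b y]
      by (simp add: inner_diff_right inner_commute field_simps)
    moreover have "\<bar>(V - U) / 2\<bar> \<le> R" if "0 \<le> U" "0 \<le> V" "U \<le> R" "V \<le> R" for U V R :: real
      using that by (simp add: abs_le_iff)
    ultimately show ?thesis using ra rb by (metis norm_ge_zero power_mono zero_le_power2)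
  qed
  then have "(y \<bullet> (a - b))\<^sup>2 \<le> r ^ 4"
    using power_mono[of "\<bar>y \<bullet> (a - b)\<bar>" "r\<^sup>2" 2] by (simp flip: power_mult)
  ultimately have nn: "\<bar>d\<^sup>2 - (norm (p - q))\<^sup>2\<bar> \<le> r ^ 4" by simp
  have "tproj y (slerp a b s) - slerp_jet p q s = e1 *\<^sub>R p + e2 *\<^sub>R q
      + (s * (1 - s) / 6 * (d\<^sup>2 - (norm (p - q))\<^sup>2)) *\<^sub>R ((2 - s) *\<^sub>R p + (1 + s) *\<^sub>R q)"
    (is "_ = ?R")
  proof -
    have comb: "(e1 + ((1 - s) + k * (2 - s) * D)) *\<^sub>R p + (e2 + (s + k * (1 + s) * D)) *\<^sub>R q
        - ((1 - s) *\<^sub>R p + s *\<^sub>R q + (k * N) *\<^sub>R ((2 - s) *\<^sub>R p + (1 + s) *\<^sub>R q))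
      = e1 *\<^sub>R p + e2 *\<^sub>R q + (k * (D - N)) *\<^sub>R ((2 - s) *\<^sub>R p + (1 + s) *\<^sub>R q)" for k D N
      by (simp add: algebra_simps)
    have "tproj y (slerp a b s) = w1 *\<^sub>R p + w2 *\<^sub>R q"
      by (simp add: w(1) p_def q_def tproj_add tproj_scaleR)
    moreover have "w1 = e1 + ((1 - s) + s * (1 - s) / 6 * (2 - s) * d\<^sup>2)"
      and "w2 = e2 + (s + s * (1 - s) / 6 * (1 + s) * d\<^sup>2)"
      by (simp_all add: e1_def e2_def)
    ultimately show ?thesis
      unfolding slerp_jet_def by (simp only: comb)
  qed
  also have "norm ?R \<le> norm (e1 *\<^sub>R p) + norm (e2 *\<^sub>R q)
      + norm ((s * (1 - s) / 6 * (d\<^sup>2 - (norm (p - q))\<^sup>2)) *\<^sub>R ((2 - s) *\<^sub>R p + (1 + s) *\<^sub>R q))"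
    by (intro norm_triangle_le add_mono order_refl norm_triangle_ineq)
  also have "\<dots> \<le> 128 * E * r ^ 5 + 128 * E * r ^ 5 + E * r ^ 5"
  proof (intro add_mono)
    have "norm (e1 *\<^sub>R p) \<le> 8 * E * (16 * r ^ 4) * r"
      unfolding norm_scaleR using e1 p by (intro mult_mono) (auto simp: E_def)
    also have "\<dots> = 128 * E * r ^ 5" by (simp add: eval_nat_numeral)
    finally show "norm (e1 *\<^sub>R p) \<le> 128 * E * r ^ 5" .
    have "norm (e2 *\<^sub>R q) \<le> 8 * E * (16 * r ^ 4) * r"
      unfolding norm_scaleR using e2 q by (intro mult_mono) (auto simp: E_def)
    also have "\<dots> = 128 * E * r ^ 5" by (simp add: eval_nat_numeral)
    finally show "norm (e2 *\<^sub>R q) \<le> 128 * E * r ^ 5" .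
    have "norm ((2 - s) *\<^sub>R p + (1 + s) *\<^sub>R q) \<le> \<bar>2 - s\<bar> * r + \<bar>1 + s\<bar> * r"
      using p q by (intro norm_triangle_le add_mono) (auto intro: mult_left_mono)
    also have "\<dots> \<le> (3 + 2 * \<bar>s\<bar>) * r"
      unfolding distrib_right[symmetric] using r0 by (intro mult_right_mono) auto
    finally have n1: "norm ((2 - s) *\<^sub>R p + (1 + s) *\<^sub>R q) \<le> (3 + 2 * \<bar>s\<bar>) * r" .
    have "\<bar>s * (1 - s) / 6\<bar> \<le> \<bar>s\<bar> * (1 + \<bar>s\<bar>) / 6"
      by (auto simp: abs_mult intro!: mult_left_mono)
    then have n2: "\<bar>s * (1 - s) / 6 * (d\<^sup>2 - (norm (p - q))\<^sup>2)\<bar> \<le> \<bar>s\<bar> * (1 + \<bar>s\<bar>) / 6 * r ^ 4"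
      unfolding abs_mult[of _ "d\<^sup>2 - (norm (p - q))\<^sup>2"] using nn by (intro mult_mono) auto
    have "norm ((s * (1 - s) / 6 * (d\<^sup>2 - (norm (p - q))\<^sup>2)) *\<^sub>R ((2 - s) *\<^sub>R p + (1 + s) *\<^sub>R q))
        \<le> (\<bar>s\<bar> * (1 + \<bar>s\<bar>) / 6 * r ^ 4) * ((3 + 2 * \<bar>s\<bar>) * r)"
      unfolding norm_scaleR[of _ "(2 - s) *\<^sub>R p + (1 + s) *\<^sub>R q"]
      using n1 n2 by (intro mult_mono) auto
    also have "\<dots> = (\<bar>s\<bar> * (1 + \<bar>s\<bar>) / 6 * (3 + 2 * \<bar>s\<bar>)) * r ^ 5"
      by (simp add: eval_nat_numeral)
    also have "\<dots> \<le> E * r ^ 5"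
    proof (rule mult_right_mono)
      have "\<bar>s\<bar> * (1 + \<bar>s\<bar>) / 6 * (3 + 2 * \<bar>s\<bar>) = \<bar>s\<bar> * (1 + \<bar>s\<bar>) * ((3 + 2 * \<bar>s\<bar>) / 6)" by simp
      also have "\<dots> \<le> (2 + \<bar>s\<bar>) * (2 + \<bar>s\<bar>) * (2 + \<bar>s\<bar>)" by (intro mult_mono) auto
      also have "\<dots> = (2 + \<bar>s\<bar>) ^ 3" by (simp add: eval_nat_numeral)
      also have "\<dots> \<le> E" unfolding E_def by (intro power_increasing) auto
      finally show "\<bar>s\<bar> * (1 + \<bar>s\<bar>) / 6 * (3 + 2 * \<bar>s\<bar>) \<le> E" .
    qed (use r0 in simp)
    finally show "norm ((s * (1 - s) / 6 * (d\<^sup>2 - (norm (p - q))\<^sup>2)) *\<^sub>R ((2 - s) *\<^sub>R p + (1 + s) *\<^sub>R q))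
        \<le> E * r ^ 5" .
  qed
  \<comment> \<open>The exact total is 257.\<close>
  also have "\<dots> \<le> 300 * E * r ^ 5" using r0 by (simp add: E_def)
  finally show ?thesis unfolding p_def q_def E_def .
qed

text \<open>The chord from \<open>a\<close> is at most the arc
  \<open>\<bar>s\<bar> * \<alpha>\<close>, and \<alpha> is at most twice the chord between the end
  points, hence at most \<open>4 * r\<close>. Extrapolated points thus stay within O(r) of
  \<open>y\<close>, and SLERP can be iterated.\<close>

lemma norm_slerp_diff_bound:
  fixes a b y :: "real^3"
  assumes a: "norm a = 1" and b: "norm b = 1"
    and ra: "norm (a - y) \<le> r" and rb: "norm (b - y) \<le> r" and r: "r \<le> 1 / 4"
  shows "norm (slerp a b s - y) \<le> (1 + 4 * \<bar>s\<bar>) * r"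
proof (cases "a = b")
  case True
  have "r \<ge> 0" using ra norm_ge_zero[of "a - y"] by linarith
  then have "r \<le> (1 + 4 * \<bar>s\<bar>) * r" by (simp add: algebra_simps)
  then show ?thesis using True slerp_same[OF a, of s] ra by simp
next
  case False
  have d2: "norm (a - b) \<le> 2 * r"
    using norm_triangle_ineq4[of "a - y" "b - y"] ra rb by simp
  then have d: "norm (a - b) \<le> 1 / 2" using r by simp
  obtain \<alpha> where \<alpha>: "a \<bullet> b = cos \<alpha>" "0 < \<alpha>" "\<alpha> \<le> 1" "\<alpha>\<^sup>2 \<le> 2 * (norm (a - b))\<^sup>2"
    using small_angle[OF a b False d] by metis
  have "2 * (norm (a - b))\<^sup>2 \<le> 4 * (norm (a - b))\<^sup>2" by (intro mult_right_mono) auto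
  with \<alpha>(4) have "\<alpha>\<^sup>2 \<le> 4 * (norm (a - b))\<^sup>2" by (rule order_trans)
  then have "\<alpha>\<^sup>2 \<le> (2 * norm (a - b))\<^sup>2" by (simp add: power_mult_distrib)
  then have al: "\<alpha> \<le> 2 * norm (a - b)" by (rule power2_le_imp_le) simp
  have c: "a \<bullet> slerp a b s = cos (s * \<alpha>)"
    using slerp_trig(2)[OF a b \<alpha>(1,2)] \<alpha>(3) pi_gt3 by auto
  have "(norm (a - slerp a b s))\<^sup>2 \<le> (\<bar>s\<bar> * \<alpha>)\<^sup>2"
    using unit_inner_eq[OF a norm_slerp[OF a, of b s]] c cos_taylor4(1)[of "s * \<alpha>"]
    by (simp add: power_mult_distrib)
  then have "norm (a - slerp a b s) \<le> \<bar>s\<bar> * \<alpha>"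
    by (rule power2_le_imp_le) (use \<alpha> in simp)
  also have "\<dots> \<le> \<bar>s\<bar> * (4 * r)" using al d2 by (intro mult_left_mono) auto
  finally have "norm (slerp a b s - a) \<le> \<bar>s\<bar> * (4 * r)" by (simp only: norm_minus_commute)
  moreover have "(1 + 4 * \<bar>s\<bar>) * r = \<bar>s\<bar> * (4 * r) + r" by (simp add: algebra_simps)
  moreover have "norm (slerp a b s - y) \<le> norm (slerp a b s - a) + norm (a - y)"
    using norm_triangle_ineq[of "slerp a b s - a" "a - y"] by simp
  ultimately show ?thesis using ra by linarith
qed

subsection \<open>Expansions in a small parameter\<close>

text \<open>The expansion parameter runs along an arbitrary filter instead of being \<open>h\<close>
  itself. In the theorem it is the pair of \<theta> and \<open>h\<close>, so that one constant valid
  along the filter is a bound uniform in \<theta>.\<close>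

locale small_parameter =
  fixes F :: "'p filter" and h :: "'p \<Rightarrow> real"
  assumes h_tendsto: "(h \<longlongrightarrow> 0) F" and h_pos: "\<forall>\<^sub>F x in F. 0 < h x"
begin

definition ord :: "nat \<Rightarrow> ('p \<Rightarrow> 'a::real_normed_vector) \<Rightarrow> bool" where
  "ord k f \<longleftrightarrow> (\<exists>C. \<forall>\<^sub>F x in F. norm (f x) \<le> C * h x ^ k)"

lemma ordI: "\<forall>\<^sub>F x in F. norm (f x) \<le> C * h x ^ k \<Longrightarrow> ord k f"
  by (auto simp: ord_def)

lemma ordE:
  assumes "ord k f"
  obtains C where "C \<ge> 0" "\<forall>\<^sub>F x in F. norm (f x) \<le> C * h x ^ k"
proof -
  obtain C where C: "\<forall>\<^sub>F x in F. norm (f x) \<le> C * h x ^ k"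
    using assms by (auto simp: ord_def)
  have "\<forall>\<^sub>F x in F. norm (f x) \<le> \<bar>C\<bar> * h x ^ k"
    using C h_pos
  proof eventually_elim
    case (elim x)
    have "C * h x ^ k \<le> \<bar>C\<bar> * h x ^ k" using elim by (intro mult_right_mono) auto
    with elim(1) show ?case by (rule order_trans)
  qed
  then show ?thesis using that[of "\<bar>C\<bar>"] by simp
qed

lemma ord_bound:
  assumes "ord k g" "\<forall>\<^sub>F x in F. norm (f x) \<le> norm (g x)"
  shows "ord k f"
proof -
  from assms(1) obtain C where "\<forall>\<^sub>F x in F. norm (g x) \<le> C * h x ^ k" by (auto simp: ord_def)
  with assms(2) have "\<forall>\<^sub>F x in F. norm (f x) \<le> C * h x ^ k"
    by eventually_elim simp
  then show ?thesis by (rule ordI)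
qed

lemma ord_cong:
  assumes "ord k g" "\<forall>\<^sub>F x in F. f x = g x"
  shows "ord k f"
  by (rule ord_bound[OF assms(1)]) (use assms(2) in \<open>auto elim: eventually_mono\<close>)

lemma ord_norm: "ord k f \<Longrightarrow> ord k (\<lambda>x. norm (f x))"
  by (simp add: ord_def)

lemma ord_add:
  assumes "ord k f" "ord k g"
  shows "ord k (\<lambda>x. f x + g x)"
proof -
  obtain C D where C: "\<forall>\<^sub>F x in F. norm (f x) \<le> C * h x ^ k" "\<forall>\<^sub>F x in F. norm (g x) \<le> D * h x ^ k"
    using assms by (auto simp: ord_def)
  from C have "\<forall>\<^sub>F x in F. norm (f x + g x) \<le> (C + D) * h x ^ k"
    by eventually_elim (auto simp: distrib_right intro!: norm_triangle_le)
  then show ?thesis by (rule ordI)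
qed

lemma ord_minus: "ord k f \<Longrightarrow> ord k (\<lambda>x. - f x)"
  by (simp add: ord_def)

lemma ord_diff: "ord k f \<Longrightarrow> ord k g \<Longrightarrow> ord k (\<lambda>x. f x - g x)"
  using ord_add[of k f "\<lambda>x. - g x"] ord_minus[of k g] by simp

lemma ord_mult_norm:
  assumes "ord j f" "ord k g" "\<forall>\<^sub>F x in F. norm (p x) \<le> norm (f x) * norm (g x)"
  shows "ord (j + k) p"
proof -
  obtain C where C: "C \<ge> 0" "\<forall>\<^sub>F x in F. norm (f x) \<le> C * h x ^ j"
    using ordE[OF assms(1)] .
  obtain D where D: "D \<ge> 0" "\<forall>\<^sub>F x in F. norm (g x) \<le> D * h x ^ k"
    using ordE[OF assms(2)] .
  have "\<forall>\<^sub>F x in F. norm (p x) \<le> (C * D) * h x ^ (j + k)"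
    using C(2) D(2) assms(3) h_pos
  proof eventually_elim
    case (elim x)
    have "norm (f x) * norm (g x) \<le> (C * h x ^ j) * (D * h x ^ k)"
      using elim C(1) by (intro mult_mono) auto
    with elim show ?case by (simp add: power_add mult_ac)
  qed
  then show ?thesis by (rule ordI)
qed

lemma ord_scaleR: "ord j f \<Longrightarrow> ord k g \<Longrightarrow> ord (j + k) (\<lambda>x. f x *\<^sub>R g x)"
  by (rule ord_mult_norm) auto

lemma ord_mult:
  fixes f g :: "'p \<Rightarrow> real"
  shows "ord j f \<Longrightarrow> ord k g \<Longrightarrow> ord (j + k) (\<lambda>x. f x * g x)"
  by (rule ord_mult_norm) (auto simp: abs_mult)

lemma ord_inner:
  fixes f g :: "'p \<Rightarrow> 'a::real_inner"
  shows "ord j f \<Longrightarrow> ord k g \<Longrightarrow> ord (j + k) (\<lambda>x. f x \<bullet> g x)"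
  using Cauchy_Schwarz_ineq2 by (intro ord_mult_norm[of j f k g] always_eventually) auto

lemma ord_const: "ord 0 (\<lambda>_. c)"
  by (rule ordI[of _ "norm c"]) simp

lemma ord_h: "ord 1 h"
  by (rule ordI[of _ 1]) (use h_pos in \<open>auto elim: eventually_mono\<close>)

lemma ord_h_power: "ord k (\<lambda>x. h x ^ k)"
  by (rule ordI[of _ 1]) (use h_pos in \<open>auto elim: eventually_mono\<close>)

lemma ord_mono:
  assumes "ord k f" "j \<le> k"
  shows "ord j f"
proof -
  obtain C where C: "C \<ge> 0" "\<forall>\<^sub>F x in F. norm (f x) \<le> C * h x ^ k"
    using ordE[OF assms(1)] .
  have "\<forall>\<^sub>F x in F. h x < 1" using order_tendstoD(2)[OF h_tendsto, of 1] by simp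
  with C(2) h_pos have "\<forall>\<^sub>F x in F. norm (f x) \<le> C * h x ^ j"
  proof eventually_elim
    case (elim x)
    have "C * h x ^ k \<le> C * h x ^ j"
      using elim C(1) assms(2) by (intro mult_left_mono power_decreasing) auto
    with elim(1) show ?case by (rule order_trans)
  qed
  then show ?thesis by (rule ordI)
qed

lemma ord_eventually_less:
  assumes "ord 1 f" "0 < e"
  shows "\<forall>\<^sub>F x in F. norm (f x) < e"
proof -
  obtain C where C: "\<forall>\<^sub>F x in F. norm (f x) \<le> C * h x ^ 1" using assms(1) by (auto simp: ord_def)
  have "((\<lambda>x. C * h x) \<longlongrightarrow> C * 0) F" by (intro tendsto_intros h_tendsto)
  then have "\<forall>\<^sub>F x in F. C * h x < e" using order_tendstoD(2) assms(2) by force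
  with C show ?thesis by eventually_elim simp
qed

text \<open>\<open>ord 0\<close> is eventual boundedness. These closure rules dispose of the
  coefficients in the expansions, which are polynomials in bounded functions of the
  parameter.\<close>

lemma ord_zero_intros:
  fixes f g :: "'p \<Rightarrow> real"
  shows "ord 0 f \<Longrightarrow> ord 0 g \<Longrightarrow> ord 0 (\<lambda>x. f x + g x)"
    "ord 0 f \<Longrightarrow> ord 0 g \<Longrightarrow> ord 0 (\<lambda>x. f x - g x)"
    "ord 0 f \<Longrightarrow> ord 0 (\<lambda>x. - f x)"
    "ord 0 f \<Longrightarrow> ord 0 g \<Longrightarrow> ord 0 (\<lambda>x. f x * g x)"
    "ord 0 f \<Longrightarrow> ord 0 (\<lambda>x. f x ^ n)"
    "ord 0 f \<Longrightarrow> ord 0 (\<lambda>x. f x / c)"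
    "ord 0 (\<lambda>_. c)"
proof -
  show m: "ord 0 f \<Longrightarrow> ord 0 g \<Longrightarrow> ord 0 (\<lambda>x. f x * g x)" for f g :: "'p \<Rightarrow> real"
    using ord_mult[of 0 f 0 g] by simp
  show "ord 0 f \<Longrightarrow> ord 0 (\<lambda>x. f x ^ n)"
    by (induction n) (auto intro: m ord_const)
  show "ord 0 f \<Longrightarrow> ord 0 (\<lambda>x. f x / c)"
    using m[of f "\<lambda>_. inverse c"] by (simp add: ord_const divide_inverse)
qed (auto intro: ord_add ord_diff ord_minus ord_const)

lemma ord_scaleR0: "ord 0 f \<Longrightarrow> ord k g \<Longrightarrow> ord k (\<lambda>x. f x *\<^sub>R g x)"
  using ord_scaleR[of 0 f k g] by simp

lemma ord_h_scaleR:
  assumes "ord 0 a" "ord 0 v"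
  shows "ord k (\<lambda>x. (h x ^ k * a x) *\<^sub>R v x)"
  using ord_scaleR[OF ord_mult[OF ord_h_power[of k] assms(1)] assms(2)] by simp

end

subsection \<open>Jets of points near a base point\<close>

text \<open>The base point \<^term>\<open>y\<close> and the projected derivatives \<^term>\<open>V\<close>, \<^term>\<open>A\<close>, \<^term>\<open>B\<close>, \<^term>\<open>E\<close>
  of the curve move with the parameter, since the expansion is centred at $\gamma(\theta h)$.\<close>
locale sphere_expansion = small_parameter F h
  for F :: "'p filter" and h :: "'p \<Rightarrow> real" +
  fixes y V A B E :: "'p \<Rightarrow> real^3"
  assumes y_unit: "\<forall>\<^sub>F x in F. norm (y x) = 1"
    and ord_V: "ord 0 V" and ord_A: "ord 0 A" and ord_B: "ord 0 B" and ord_E: "ord 0 E"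
begin

definition jet :: "('p \<Rightarrow> real) \<Rightarrow> ('p \<Rightarrow> real) \<Rightarrow> ('p \<Rightarrow> real) \<Rightarrow> ('p \<Rightarrow> real) \<Rightarrow>
    ('p \<Rightarrow> real) \<Rightarrow> ('p \<Rightarrow> real) \<Rightarrow> ('p \<Rightarrow> real) \<Rightarrow> 'p \<Rightarrow> real^3" where
  "jet a1 a2 a3 a4 c1 c2 c3 x =
     (h x * a1 x) *\<^sub>R V x + (h x ^ 2 * a2 x) *\<^sub>R A x + (h x ^ 3 * a3 x) *\<^sub>R B x + (h x ^ 4 * a4 x) *\<^sub>R E x
     + (h x ^ 3 * c1 x) *\<^sub>R ((norm (V x))\<^sup>2 *\<^sub>R V x)
     + (h x ^ 4 * c2 x) *\<^sub>R ((norm (V x))\<^sup>2 *\<^sub>R A x)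
     + (h x ^ 4 * c3 x) *\<^sub>R ((V x \<bullet> A x) *\<^sub>R V x)"

text \<open>A unit vector is determined by its projection only up to reflection in the plane
  orthogonal to \<open>y x\<close>; the bound on \<open>a x - y x\<close> selects the point near the
  base point. Boundedness of the coefficients is included so that SLERP preserves the
  predicate.\<close>

definition has_jet :: "('p \<Rightarrow> real^3) \<Rightarrow> ('p \<Rightarrow> real) \<Rightarrow> ('p \<Rightarrow> real) \<Rightarrow> ('p \<Rightarrow> real) \<Rightarrow> ('p \<Rightarrow> real) \<Rightarrow>
    ('p \<Rightarrow> real) \<Rightarrow> ('p \<Rightarrow> real) \<Rightarrow> ('p \<Rightarrow> real) \<Rightarrow> bool" where
  "has_jet a a1 a2 a3 a4 c1 c2 c3 \<longleftrightarrow>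
     (\<forall>\<^sub>F x in F. norm (a x) = 1) \<and> ord 1 (\<lambda>x. a x - y x) \<and>
     (\<forall>c \<in> {a1, a2, a3, a4, c1, c2, c3}. ord 0 c) \<and>
     ord 5 (\<lambda>x. tproj (y x) (a x) - jet a1 a2 a3 a4 c1 c2 c3 x)"

lemma ord_VV: "ord 0 (\<lambda>x. (norm (V x))\<^sup>2)" and ord_VA: "ord 0 (\<lambda>x. V x \<bullet> A x)"
  and ord_AA: "ord 0 (\<lambda>x. (norm (A x))\<^sup>2)"
  using ord_inner[OF ord_V ord_V] ord_inner[OF ord_A ord_A] ord_inner[OF ord_V ord_A]
  by (simp_all add: power2_norm_eq_inner)

text \<open>The correction term of SLERP is cubic in the points, so modulo O(h^5) it sees only the
  first two terms of their jets.\<close>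

lemma ord_jet_tail:
  assumes "has_jet a a1 a2 a3 a4 c1 c2 c3"
  shows "ord 3 (\<lambda>x. tproj (y x) (a x) - ((h x * a1 x) *\<^sub>R V x + (h x ^ 2 * a2 x) *\<^sub>R A x))"
proof -
  have o: "ord 0 a3" "ord 0 a4" "ord 0 c1" "ord 0 c2" "ord 0 c3"
    and r: "ord 5 (\<lambda>x. tproj (y x) (a x) - jet a1 a2 a3 a4 c1 c2 c3 x)"
    using assms by (auto simp: has_jet_def)
  have 4: "ord 3 (\<lambda>x. (h x ^ 4 * c x) *\<^sub>R v x)" if "ord 0 c" "ord 0 v" for c and v :: "'p \<Rightarrow> real^3"
    by (rule ord_mono[OF ord_h_scaleR[OF that]]) simp
  have "ord 3 (\<lambda>x. (tproj (y x) (a x) - jet a1 a2 a3 a4 c1 c2 c3 x)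
     + ((h x ^ 3 * a3 x) *\<^sub>R B x + (h x ^ 4 * a4 x) *\<^sub>R E x
     + (h x ^ 3 * c1 x) *\<^sub>R ((norm (V x))\<^sup>2 *\<^sub>R V x)
     + (h x ^ 4 * c2 x) *\<^sub>R ((norm (V x))\<^sup>2 *\<^sub>R A x)
     + (h x ^ 4 * c3 x) *\<^sub>R ((V x \<bullet> A x) *\<^sub>R V x)))"
    by (intro ord_add 4 ord_h_scaleR ord_scaleR0 o ord_V ord_A ord_B ord_E ord_VV ord_VA ord_mono[OF r]) simp
  then show ?thesis
    by (rule ord_cong) (simp add: jet_def algebra_simps)
qed

text \<open>An error of order 3 in one factor is multiplied by two factors of order 1 and so lands
  in order 5. Of the product of the truncations only the terms of order 3 and 4 remain.\<close>

lemma ord_cubic: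
  fixes d m :: "'p \<Rightarrow> real^3"
  assumes d: "ord 3 (\<lambda>x. d x - ((h x * a x) *\<^sub>R V x + (h x ^ 2 * b x) *\<^sub>R A x))"
    and m: "ord 3 (\<lambda>x. m x - ((h x * m1 x) *\<^sub>R V x + (h x ^ 2 * m2 x) *\<^sub>R A x))"
    and o: "ord 0 a" "ord 0 b" "ord 0 m1" "ord 0 m2"
  shows "ord 5 (\<lambda>x. (norm (d x))\<^sup>2 *\<^sub>R m x -
     ((h x ^ 3 * ((a x)\<^sup>2 * m1 x)) *\<^sub>R ((norm (V x))\<^sup>2 *\<^sub>R V x)
      + (h x ^ 4 * ((a x)\<^sup>2 * m2 x)) *\<^sub>R ((norm (V x))\<^sup>2 *\<^sub>R A x)
      + (h x ^ 4 * (2 * a x * b x * m1 x)) *\<^sub>R ((V x \<bullet> A x) *\<^sub>R V x)))"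
proof -
  define D where "D x = (h x * a x) *\<^sub>R V x + (h x ^ 2 * b x) *\<^sub>R A x" for x
  define N where "N x = (h x * m1 x) *\<^sub>R V x + (h x ^ 2 * m2 x) *\<^sub>R A x" for x
  have lin: "ord 1 (\<lambda>x. (h x * c x) *\<^sub>R V x + (h x ^ 2 * e x) *\<^sub>R A x)" if "ord 0 c" "ord 0 e" for c e
  proof (rule ord_add)
    show "ord 1 (\<lambda>x. (h x * c x) *\<^sub>R V x)" using ord_h_scaleR[OF that(1) ord_V, of 1] by simp
    show "ord 1 (\<lambda>x. (h x ^ 2 * e x) *\<^sub>R A x)" by (rule ord_mono[OF ord_h_scaleR[OF that(2) ord_A]]) simp
  qed
  have D: "ord 1 D" and N: "ord 1 N"
    unfolding D_def N_def by (intro lin o)+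
  have rd: "ord 3 (\<lambda>x. d x - D x)" and rm: "ord 3 (\<lambda>x. m x - N x)"
    using d m by (simp_all add: D_def N_def)
  have d1: "ord 1 d" using ord_add[OF ord_mono[OF rd] D, simplified] by simp
  have m1: "ord 1 m" using ord_add[OF ord_mono[OF rm] N, simplified] by simp
  have t1: "ord 5 (\<lambda>x. ((d x - D x) \<bullet> (d x + D x)) *\<^sub>R m x)"
    using ord_scaleR[OF ord_inner[OF rd ord_add[OF d1 D]] m1] by simp
  have t2: "ord 5 (\<lambda>x. (h x ^ 4 * ((b x)\<^sup>2 * (norm (A x))\<^sup>2)) *\<^sub>R m x)"
    using ord_scaleR[OF ord_mult[OF ord_h_power[of 4], of 0 "\<lambda>x. (b x)\<^sup>2 * (norm (A x))\<^sup>2"] m1]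
      ord_AA o by (simp add: ord_zero_intros)
  have "ord 2 (\<lambda>x. h x ^ 2 * ((a x)\<^sup>2 * (norm (V x))\<^sup>2) + h x ^ 3 * (2 * a x * b x * (V x \<bullet> A x)))"
    using ord_mult[OF ord_h_power[of 2], of 0 "\<lambda>x. (a x)\<^sup>2 * (norm (V x))\<^sup>2"]
      ord_mono[OF ord_mult[OF ord_h_power[of 3], of 0 "\<lambda>x. 2 * a x * b x * (V x \<bullet> A x)"], of 2]
      ord_VV ord_VA o by (auto intro!: ord_add simp: ord_zero_intros)
  from ord_scaleR[OF this rm]
  have t3: "ord 5 (\<lambda>x. (h x ^ 2 * ((a x)\<^sup>2 * (norm (V x))\<^sup>2) + h x ^ 3 * (2 * a x * b x * (V x \<bullet> A x))) *\<^sub>R (m x - N x))"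
    by simp
  have t4: "ord 5 (\<lambda>x. (h x ^ 5 * (2 * a x * b x * m2 x * (V x \<bullet> A x))) *\<^sub>R A x)"
    by (intro ord_h_scaleR ord_A ord_zero_intros ord_VA o)
  \<comment> \<open>The difference of squares isolates an error of order 4; the rest is the exact
    square of the truncation \<open>D\<close>.\<close>
  have sq: "(norm (d x))\<^sup>2 = (d x - D x) \<bullet> (d x + D x) + h x ^ 4 * ((b x)\<^sup>2 * (norm (A x))\<^sup>2)
      + (h x ^ 2 * ((a x)\<^sup>2 * (norm (V x))\<^sup>2) + h x ^ 3 * (2 * a x * b x * (V x \<bullet> A x)))" for x
  proof -
    have "D x \<bullet> D x = h x ^ 4 * ((b x)\<^sup>2 * (A x \<bullet> A x))
      + (h x ^ 2 * ((a x)\<^sup>2 * (V x \<bullet> V x)) + h x ^ 3 * (2 * a x * b x * (V x \<bullet> A x)))"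
      unfolding D_def by (simp add: inner_add_left inner_add_right inner_commute power2_eq_square
          power3_eq_cube power4_eq_xxxx algebra_simps)
    then show ?thesis
      unfolding power2_norm_eq_inner
      by (simp add: inner_add_left inner_add_right inner_diff_left inner_diff_right inner_commute)
  qed
  have id: "(norm (d x))\<^sup>2 *\<^sub>R m x -
     ((h x ^ 3 * ((a x)\<^sup>2 * m1 x)) *\<^sub>R ((norm (V x))\<^sup>2 *\<^sub>R V x)
      + (h x ^ 4 * ((a x)\<^sup>2 * m2 x)) *\<^sub>R ((norm (V x))\<^sup>2 *\<^sub>R A x)
      + (h x ^ 4 * (2 * a x * b x * m1 x)) *\<^sub>R ((V x \<bullet> A x) *\<^sub>R V x))
    = ((d x - D x) \<bullet> (d x + D x)) *\<^sub>R m x + (h x ^ 4 * ((b x)\<^sup>2 * (norm (A x))\<^sup>2)) *\<^sub>R m x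
      + (h x ^ 2 * ((a x)\<^sup>2 * (norm (V x))\<^sup>2) + h x ^ 3 * (2 * a x * b x * (V x \<bullet> A x))) *\<^sub>R (m x - N x)
      + (h x ^ 5 * (2 * a x * b x * m2 x * (V x \<bullet> A x))) *\<^sub>R A x" for x
  proof -
    have "(h x ^ 2 * ((a x)\<^sup>2 * (norm (V x))\<^sup>2) + h x ^ 3 * (2 * a x * b x * (V x \<bullet> A x))) *\<^sub>R N x
      = (h x ^ 3 * ((a x)\<^sup>2 * m1 x)) *\<^sub>R ((norm (V x))\<^sup>2 *\<^sub>R V x)
      + (h x ^ 4 * ((a x)\<^sup>2 * m2 x)) *\<^sub>R ((norm (V x))\<^sup>2 *\<^sub>R A x)
      + (h x ^ 4 * (2 * a x * b x * m1 x)) *\<^sub>R ((V x \<bullet> A x) *\<^sub>R V x)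
      + (h x ^ 5 * (2 * a x * b x * m2 x * (V x \<bullet> A x))) *\<^sub>R A x"
      unfolding N_def by (simp add: algebra_simps eval_nat_numeral)
    then show ?thesis
      unfolding sq[of x] by (simp add: scaleR_add_left scaleR_diff_right)
  qed
  show ?thesis unfolding id by (intro ord_add t1 t2 t3 t4)
qed

text \<open>Every coefficient is interpolated linearly; the correction term is cubic and by
  \<open>ord_cubic\<close> reaches only the last three. The new coefficients enter through
  equations, so that an application can supply them in simplified form and is left with polynomial
  identities.\<close>

lemma has_jet_slerp:
  assumes a: "has_jet a a1 a2 a3 a4 c1 c2 c3" and b: "has_jet b b1 b2 b3 b4 d1 d2 d3" and s: "ord 0 s"
    and e: "\<And>x. e1 x = (1 - s x) * a1 x + s x * b1 x"
      "\<And>x. e2 x = (1 - s x) * a2 x + s x * b2 x"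
      "\<And>x. e3 x = (1 - s x) * a3 x + s x * b3 x"
      "\<And>x. e4 x = (1 - s x) * a4 x + s x * b4 x"
    and f: "\<And>x. f1 x = (1 - s x) * c1 x + s x * d1 x + s x * (1 - s x) / 6 *
        ((a1 x - b1 x)\<^sup>2 * ((2 - s x) * a1 x + (1 + s x) * b1 x))"
      "\<And>x. f2 x = (1 - s x) * c2 x + s x * d2 x + s x * (1 - s x) / 6 *
        ((a1 x - b1 x)\<^sup>2 * ((2 - s x) * a2 x + (1 + s x) * b2 x))"
      "\<And>x. f3 x = (1 - s x) * c3 x + s x * d3 x + s x * (1 - s x) / 6 *
        (2 * (a1 x - b1 x) * (a2 x - b2 x) * ((2 - s x) * a1 x + (1 + s x) * b1 x))"
  shows "has_jet (\<lambda>x. slerp (a x) (b x) (s x)) e1 e2 e3 e4 f1 f2 f3"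
proof -
  have au: "\<forall>\<^sub>F x in F. norm (a x) = 1" and ay: "ord 1 (\<lambda>x. a x - y x)"
    and aj: "ord 5 (\<lambda>x. tproj (y x) (a x) - jet a1 a2 a3 a4 c1 c2 c3 x)"
    and ao: "ord 0 a1" "ord 0 a2" "ord 0 a3" "ord 0 a4" "ord 0 c1" "ord 0 c2" "ord 0 c3"
    using a by (auto simp: has_jet_def)
  have bu: "\<forall>\<^sub>F x in F. norm (b x) = 1" and bY: "ord 1 (\<lambda>x. b x - y x)"
    and bj: "ord 5 (\<lambda>x. tproj (y x) (b x) - jet b1 b2 b3 b4 d1 d2 d3 x)"
    and bo: "ord 0 b1" "ord 0 b2" "ord 0 b3" "ord 0 b4" "ord 0 d1" "ord 0 d2" "ord 0 d3"
    using b by (auto simp: has_jet_def)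
  have eo: "ord 0 e1" "ord 0 e2" "ord 0 e3" "ord 0 e4" "ord 0 f1" "ord 0 f2" "ord 0 f3"
    unfolding e[abs_def] f[abs_def] by (intro ord_zero_intros ao bo s)+
  \<comment> \<open>A common radius for both end points, as the SLERP bounds require.\<close>
  define r where "r x = norm (a x - y x) + norm (b x - y x)" for x
  have r: "ord 1 r" unfolding r_def by (intro ord_add ord_norm ay bY)
  have r4: "\<forall>\<^sub>F x in F. r x < 1 / 4"
    using ord_eventually_less[OF r, of "1 / 4"] by (auto elim: eventually_mono)
  have r0: "norm (a x - y x) \<le> r x" "norm (b x - y x) \<le> r x" "0 \<le> r x" for x
    by (simp_all add: r_def)
  have s': "ord 0 (\<lambda>x. \<bar>s x\<bar>)" using ord_norm[OF s] by simp
  have su: "\<forall>\<^sub>F x in F. norm (slerp (a x) (b x) (s x)) = 1"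
    using au by eventually_elim (rule norm_slerp)
  have close: "ord 1 (\<lambda>x. slerp (a x) (b x) (s x) - y x)"
  proof (rule ord_bound)
    show "ord 1 (\<lambda>x. (1 + 4 * \<bar>s x\<bar>) * r x)"
      using ord_mult[OF _ r, of 0 "\<lambda>x. 1 + 4 * \<bar>s x\<bar>"] s' by (simp add: ord_zero_intros)
    show "\<forall>\<^sub>F x in F. norm (slerp (a x) (b x) (s x) - y x) \<le> norm ((1 + 4 * \<bar>s x\<bar>) * r x)"
      using au bu r4
    proof eventually_elim
      case (elim x)
      have "norm (slerp (a x) (b x) (s x) - y x) \<le> (1 + 4 * \<bar>s x\<bar>) * r x"
        using elim r0[of x] by (intro norm_slerp_diff_bound) auto
      then show ?case by simp
    qed
  qed
  let ?p = "\<lambda>x. tproj (y x) (a x)" and ?q = "\<lambda>x. tproj (y x) (b x)"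
  let ?m = "\<lambda>x. (2 - s x) *\<^sub>R ?p x + (1 + s x) *\<^sub>R ?q x"
  have main: "ord 5 (\<lambda>x. tproj (y x) (slerp (a x) (b x) (s x)) - slerp_jet (?p x) (?q x) (s x))"
  proof (rule ord_bound)
    have "ord 5 (\<lambda>x. r x ^ 5)"
      using ord_mult[OF r ord_mult[OF r ord_mult[OF r ord_mult[OF r r]]]] by (simp add: eval_nat_numeral)
    from ord_mult[OF _ this, of 0 "\<lambda>x. 300 * (2 + \<bar>s x\<bar>) ^ 5"]
    show "ord 5 (\<lambda>x. 300 * (2 + \<bar>s x\<bar>) ^ 5 * r x ^ 5)"
      using s' by (simp add: ord_zero_intros)
    show "\<forall>\<^sub>F x in F. norm (tproj (y x) (slerp (a x) (b x) (s x)) - slerp_jet (?p x) (?q x) (s x))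
        \<le> norm (300 * (2 + \<bar>s x\<bar>) ^ 5 * r x ^ 5)"
      using au bu r4 y_unit
    proof eventually_elim
      case (elim x)
      have "norm (tproj (y x) (slerp (a x) (b x) (s x)) - slerp_jet (?p x) (?q x) (s x))
          \<le> 300 * (2 + \<bar>s x\<bar>) ^ 5 * r x ^ 5"
        using elim r0[of x] by (intro tproj_slerp_bound) auto
      then show ?case unfolding real_norm_def by (rule order_trans[OF _ abs_ge_self])
    qed
  qed
  have d: "ord 3 (\<lambda>x. (?p x - ?q x) - ((h x * (a1 x - b1 x)) *\<^sub>R V x + (h x ^ 2 * (a2 x - b2 x)) *\<^sub>R A x))"
    by (rule ord_cong[OF ord_diff[OF ord_jet_tail[OF a] ord_jet_tail[OF b]]])
      (simp add: algebra_simps)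
  have m: "ord 3 (\<lambda>x. ?m x - ((h x * ((2 - s x) * a1 x + (1 + s x) * b1 x)) *\<^sub>R V x
      + (h x ^ 2 * ((2 - s x) * a2 x + (1 + s x) * b2 x)) *\<^sub>R A x))"
    by (rule ord_cong[OF ord_add[OF ord_scaleR0[OF _ ord_jet_tail[OF a], of "\<lambda>x. 2 - s x"]
          ord_scaleR0[OF _ ord_jet_tail[OF b], of "\<lambda>x. 1 + s x"]]])
      (auto intro: ord_zero_intros s simp: algebra_simps)
  note cub = ord_cubic[OF d m]
  \<comment> \<open>The four errors: of the SLERP model, inherited from \<open>a\<close>, inherited
    from \<open>b\<close>, and of the cubic term.\<close>
  have "ord 5 (\<lambda>x. (tproj (y x) (slerp (a x) (b x) (s x)) - slerp_jet (?p x) (?q x) (s x))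
     + (1 - s x) *\<^sub>R (?p x - jet a1 a2 a3 a4 c1 c2 c3 x) + s x *\<^sub>R (?q x - jet b1 b2 b3 b4 d1 d2 d3 x)
     + (s x * (1 - s x) / 6) *\<^sub>R ((norm (?p x - ?q x))\<^sup>2 *\<^sub>R ?m x -
     ((h x ^ 3 * ((a1 x - b1 x)\<^sup>2 * ((2 - s x) * a1 x + (1 + s x) * b1 x))) *\<^sub>R ((norm (V x))\<^sup>2 *\<^sub>R V x)
      + (h x ^ 4 * ((a1 x - b1 x)\<^sup>2 * ((2 - s x) * a2 x + (1 + s x) * b2 x))) *\<^sub>R ((norm (V x))\<^sup>2 *\<^sub>R A x)
      + (h x ^ 4 * (2 * (a1 x - b1 x) * (a2 x - b2 x) * ((2 - s x) * a1 x + (1 + s x) * b1 x))) *\<^sub>R ((V x \<bullet> A x) *\<^sub>R V x))))"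
    by (intro ord_add main ord_scaleR0 aj bj cub ord_zero_intros s ao bo)
  then have "ord 5 (\<lambda>x. tproj (y x) (slerp (a x) (b x) (s x)) - jet e1 e2 e3 e4 f1 f2 f3 x)"
  proof (rule ord_cong, intro always_eventually allI)
    fix x
    \<comment> \<open>Collecting coefficients is a linear identity, so it is proved with the
      nonlinear quantities as unknowns.\<close>
    have lin: "\<mu> *\<^sub>R (p - jet a1 a2 a3 a4 c1 c2 c3 x) + s x *\<^sub>R (q - jet b1 b2 b3 b4 d1 d2 d3 x)
      + \<kappa> *\<^sub>R (w - ((h x ^ 3 * k1) *\<^sub>R ((norm (V x))\<^sup>2 *\<^sub>R V x)
        + (h x ^ 4 * k2) *\<^sub>R ((norm (V x))\<^sup>2 *\<^sub>R A x)
        + (h x ^ 4 * k3) *\<^sub>R ((V x \<bullet> A x) *\<^sub>R V x)))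
      = \<mu> *\<^sub>R p + s x *\<^sub>R q + \<kappa> *\<^sub>R w -
        ((h x * (\<mu> * a1 x + s x * b1 x)) *\<^sub>R V x + (h x ^ 2 * (\<mu> * a2 x + s x * b2 x)) *\<^sub>R A x
        + (h x ^ 3 * (\<mu> * a3 x + s x * b3 x)) *\<^sub>R B x + (h x ^ 4 * (\<mu> * a4 x + s x * b4 x)) *\<^sub>R E x
        + (h x ^ 3 * (\<mu> * c1 x + s x * d1 x + \<kappa> * k1)) *\<^sub>R ((norm (V x))\<^sup>2 *\<^sub>R V x)
        + (h x ^ 4 * (\<mu> * c2 x + s x * d2 x + \<kappa> * k2)) *\<^sub>R ((norm (V x))\<^sup>2 *\<^sub>R A x)
        + (h x ^ 4 * (\<mu> * c3 x + s x * d3 x + \<kappa> * k3)) *\<^sub>R ((V x \<bullet> A x) *\<^sub>R V x))"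
      for \<mu> \<kappa> k1 k2 k3 p q w
      unfolding jet_def by (simp add: algebra_simps)
    show "tproj (y x) (slerp (a x) (b x) (s x)) - jet e1 e2 e3 e4 f1 f2 f3 x =
      (tproj (y x) (slerp (a x) (b x) (s x)) - slerp_jet (?p x) (?q x) (s x))
     + (1 - s x) *\<^sub>R (?p x - jet a1 a2 a3 a4 c1 c2 c3 x) + s x *\<^sub>R (?q x - jet b1 b2 b3 b4 d1 d2 d3 x)
     + (s x * (1 - s x) / 6) *\<^sub>R ((norm (?p x - ?q x))\<^sup>2 *\<^sub>R ?m x -
     ((h x ^ 3 * ((a1 x - b1 x)\<^sup>2 * ((2 - s x) * a1 x + (1 + s x) * b1 x))) *\<^sub>R ((norm (V x))\<^sup>2 *\<^sub>R V x)
      + (h x ^ 4 * ((a1 x - b1 x)\<^sup>2 * ((2 - s x) * a2 x + (1 + s x) * b2 x))) *\<^sub>R ((norm (V x))\<^sup>2 *\<^sub>R A x)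
      + (h x ^ 4 * (2 * (a1 x - b1 x) * (a2 x - b2 x) * ((2 - s x) * a1 x + (1 + s x) * b1 x))) *\<^sub>R ((V x \<bullet> A x) *\<^sub>R V x)))"
      unfolding add.assoc[of "_ - slerp_jet _ _ _"] lin
      unfolding jet_def[of e1] e f slerp_jet_def
      by (simp only: scaleR_scaleR add_diff_eq diff_add_cancel)
  qed
  then show ?thesis
    using su close eo by (simp add: has_jet_def)
qed

end

subsection \<open>The logarithm as an analytic function\<close>

text \<open>The coefficients $2^n (n!)^2/(2n+1)!$ of $\alpha/\sin\alpha$ as a power series in
  $1 - \cos\alpha$. The series continues this function across $\alpha = 0$, where
  \<^const>\<open>sphere_log\<close> has to be differentiated.\<close>
primrec arc_coeff :: "nat \<Rightarrow> real" where
  "arc_coeff 0 = 1"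
| "arc_coeff (Suc n) = real (n + 1) / real (2 * n + 3) * arc_coeff n"

text \<open>The index \<open>k\<close> counts formal derivatives, so that differentiation shifts it
  by one.\<close>

definition arc_series :: "nat \<Rightarrow> real \<Rightarrow> real" where
  "arc_series k x = (\<Sum>n. (diffs ^^ k) arc_coeff n * x ^ n)"

text \<open>Successive coefficients have ratio below 1/2, so the series converges for modulus below
  2. This covers 1 - cos \<alpha> for all \<alpha> strictly between -pi and pi.\<close>

lemma arc_coeff_bounds: "0 \<le> arc_coeff n \<and> arc_coeff n \<le> (1 / 2) ^ n"
proof (induction n)
  case (Suc n)
  have "real (n + 1) / real (2 * n + 3) * arc_coeff n \<le> 1 / 2 * (1 / 2) ^ n"
    using Suc by (intro mult_mono) (auto simp: field_simps)
  with Suc show ?case by simp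
qed simp

lemma summable_arc_coeff:
  assumes "\<bar>x\<bar> < 2"
  shows "summable (\<lambda>n. (diffs ^^ k) arc_coeff n * x ^ n)"
  using assms
proof (induction k arbitrary: x)
  case 0
  have "summable (\<lambda>n. (\<bar>x\<bar> / 2) ^ n)" using 0 by (intro summable_geometric) auto
  moreover have "norm (arc_coeff n * x ^ n) \<le> (\<bar>x\<bar> / 2) ^ n" for n
    using arc_coeff_bounds[of n] mult_right_mono[of "arc_coeff n" "(1/2) ^ n" "\<bar>x\<bar> ^ n"]
    by (simp add: abs_mult power_abs power_divide)
  ultimately have "summable (\<lambda>n. arc_coeff n * x ^ n)"
    by (rule summable_comparison_test'[where N = 0])
  then show ?case by simp
next
  case (Suc k)
  have "summable (\<lambda>n. diffs ((diffs ^^ k) arc_coeff) n * x ^ n)"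
    by (rule termdiff_converges[where K = 2]) (use Suc in auto)
  then show ?case by simp
qed

lemma DERIV_arc_series:
  assumes "\<bar>x\<bar> < 2"
  shows "(arc_series k has_real_derivative arc_series (Suc k) x) (at x)"
proof -
  \<comment> \<open>Termwise differentiation at \<open>x\<close> needs convergence at a point of
    larger modulus, still below 2.\<close>
  define K where "K = (\<bar>x\<bar> + 2) / 2"
  have "\<bar>K\<bar> < 2" "\<bar>x\<bar> < \<bar>K\<bar>" using assms by (auto simp: K_def)
  then show ?thesis
    unfolding arc_series_def[abs_def]
    using termdiffs_strong[OF summable_arc_coeff[of K k], of x] by simp
qed

lemma arc_series_zero: "arc_series 0 0 = 1" "arc_series (Suc 0) 0 = 1 / 3"
  unfolding arc_series_def powser_zero by (simp_all add: diffs_def)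

text \<open>With x = 1 - cos \<alpha>, so that x(2 - x) = sin(\<alpha>)^2, this is the derivative of
  the relation sin \<alpha> F(1 - cos \<alpha>) = \<alpha>. For the series it is the recurrence
  (2n+3) c(n+1) = (n+1) c(n), multiplied by x^(n+1) and summed.\<close>

lemma arc_series_ode:
  assumes "\<bar>x\<bar> < 2"
  shows "x * (2 - x) * arc_series 1 x = 1 - (1 - x) * arc_series 0 x"
proof -
  define S where "S n = arc_coeff n * x ^ n" for n
  define T where "T n = real n * arc_coeff n * x ^ n" for n
  have S: "S sums arc_series 0 x"
    using summable_arc_coeff[OF assms, of 0] by (simp add: S_def[abs_def] arc_series_def summable_sums)
  have "(\<lambda>n. x * (real n * arc_coeff n * x ^ (n - Suc 0))) sums (x * arc_series 1 x)"
    using diffs_equiv[of arc_coeff x] summable_arc_coeff[OF assms, of 1]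
    by (intro sums_mult) (simp add: arc_series_def)
  moreover have "x * (real n * arc_coeff n * x ^ (n - Suc 0)) = T n" for n
    by (cases n) (simp_all add: T_def)
  ultimately have T: "T sums (x * arc_series 1 x)" by simp
  have "(\<lambda>n. 2 * T n + S n) sums (2 * (x * arc_series 1 x) + arc_series 0 x)"
    by (intro sums_add sums_mult S T)
  \<comment> \<open>Since \<open>T 0 = 0\<close> and \<open>S 0 = 1\<close>, dropping the first term
    subtracts 1.\<close>
  then have "(\<lambda>n. 2 * T (Suc n) + S (Suc n)) sums (2 * (x * arc_series 1 x) + arc_series 0 x - 1)"
    using sums_Suc_iff[of "\<lambda>n. 2 * T n + S n" "2 * (x * arc_series 1 x) + arc_series 0 x - 1"]
    by (simp add: T_def S_def)
  moreover have "2 * T (Suc n) + S (Suc n) = x * (T n + S n)" for n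
  proof -
    have "2 * T (Suc n) + S (Suc n) = real (2 * n + 3) * arc_coeff (Suc n) * x ^ Suc n"
    proof -
      have "2 * (real (Suc n) * c * X) + c * X = real (2 * n + 3) * c * X" for c X
        by (simp add: algebra_simps)
      then show ?thesis unfolding T_def S_def .
    qed
    also have "real (2 * n + 3) * arc_coeff (Suc n) = real (n + 1) * arc_coeff n"
      by simp
    also have "real (n + 1) * arc_coeff n * x ^ Suc n = x * (T n + S n)"
      unfolding T_def S_def by (simp add: algebra_simps)
    finally show ?thesis .
  qed
  ultimately have "(\<lambda>n. x * (T n + S n)) sums (2 * (x * arc_series 1 x) + arc_series 0 x - 1)"
    by simp
  moreover have "(\<lambda>n. x * (T n + S n)) sums (x * (x * arc_series 1 x + arc_series 0 x))"
    by (intro sums_add sums_mult S T)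
  ultimately have "2 * (x * arc_series 1 x) + arc_series 0 x - 1 = x * (x * arc_series 1 x + arc_series 0 x)"
    by (rule sums_unique2)
  then show ?thesis by (simp add: algebra_simps)
qed

lemma cos_gt_minus_one:
  assumes "- pi < x" "x < pi"
  shows "- 1 < cos x"
proof -
  have "cos \<bar>x\<bar> > cos pi" using assms by (intro cos_monotone_0_pi) auto
  then show ?thesis by (simp add: abs_if split: if_splits)
qed

text \<open>By the differential equation the difference of the two sides has zero derivative on the
  whole interval, and it vanishes at 0. The product form avoids the quotient \<alpha> / sin \<alpha>
  at 0.\<close>

lemma sin_arc_series:
  assumes "- pi < \<alpha>" "\<alpha> < pi"
  shows "sin \<alpha> * arc_series 0 (1 - cos \<alpha>) = \<alpha>"
proof -
  have "\<exists>c. \<forall>x\<in>{- pi<..<pi}. sin x * arc_series 0 (1 - cos x) - x = c"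
  proof (rule has_field_derivative_zero_constant)
    fix x :: real
    assume x: "x \<in> {- pi<..<pi}"
    then have b: "\<bar>1 - cos x\<bar> < 2" using cos_gt_minus_one[of x] cos_le_one[of x] by auto
    have eq: "(1 - cos x) * (2 - (1 - cos x)) = (sin x)\<^sup>2"
      by (simp add: sin_squared_eq algebra_simps power2_eq_square)
    have ode: "(sin x)\<^sup>2 * arc_series (Suc 0) (1 - cos x) + cos x * arc_series 0 (1 - cos x) = 1"
      using arc_series_ode[OF b] unfolding eq by simp
    have "((\<lambda>x. arc_series 0 (1 - cos x)) has_real_derivative arc_series (Suc 0) (1 - cos x) * sin x) (at x)"
      by (rule DERIV_chain2[of "arc_series 0" _ "\<lambda>x. 1 - cos x", OF DERIV_arc_series[OF b, of 0]]) (auto intro!: derivative_eq_intros)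
    then have "((\<lambda>x. sin x * arc_series 0 (1 - cos x) - x) has_real_derivative
        cos x * arc_series 0 (1 - cos x) + arc_series (Suc 0) (1 - cos x) * sin x * sin x - 1) (at x)"
      by (auto intro!: derivative_eq_intros)
    also have "cos x * arc_series 0 (1 - cos x) + arc_series (Suc 0) (1 - cos x) * sin x * sin x - 1 = 0"
      using ode by (simp add: power2_eq_square mult_ac)
    finally show "((\<lambda>x. sin x * arc_series 0 (1 - cos x) - x) has_real_derivative 0) (at x within {- pi<..<pi})"
      by (rule has_field_derivative_at_within)
  qed simp
  then obtain c where c: "sin x * arc_series 0 (1 - cos x) - x = c" if "x \<in> {- pi<..<pi}" for x by blast
  have "c = 0" using c[of 0] by simp
  then show ?thesis using c[of \<alpha>] assms by simp
qed

text \<open>At \<open>z = y\<close> the quotient in \<open>sphere_log\<close> is 0/0, but the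
  projection vanishes there. The formula therefore holds across this point and exhibits the
  logarithm as a smooth function of \<open>z\<close>.\<close>

lemma sphere_log_arc_series:
  assumes "norm y = 1" "norm z = 1" "y \<bullet> z > - 1"
  shows "sphere_log y z = arc_series 0 (1 - y \<bullet> z) *\<^sub>R tproj y z"
proof (cases "y \<bullet> z = 1")
  case True
  then have "norm (y - z) = 0" using unit_inner_eq[OF assms(1,2)] by simp
  then show ?thesis using assms by (simp add: sphere_log_self tproj_self)
next
  case False
  define \<alpha> where "\<alpha> = arccos (y \<bullet> z)"
  have w: "-1 < y \<bullet> z" "y \<bullet> z < 1" using unit_inner_bounds[OF assms(1,2)] assms(3) False by auto
  then have \<alpha>: "0 < \<alpha>" "\<alpha> < pi" unfolding \<alpha>_def using arccos_lt_bounded[of "y \<bullet> z"] by auto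
  have "cos \<alpha> = y \<bullet> z" unfolding \<alpha>_def using w by simp
  then have "sin \<alpha> * arc_series 0 (1 - y \<bullet> z) = \<alpha>" using sin_arc_series[of \<alpha>] \<alpha> by simp
  moreover have "sin \<alpha> > 0" using \<alpha> by (simp add: sin_gt_zero)
  ultimately have "\<alpha> / sin \<alpha> = arc_series 0 (1 - y \<bullet> z)" by (simp add: field_simps)
  then show ?thesis unfolding sphere_log_tproj \<alpha>_def by simp
qed

subsection \<open>Derivatives of the normal coordinate\<close>

lemma nth_vector_derivative_0: "nth_vector_derivative 0 f = f"
  and nth_vector_derivative_Suc:
    "nth_vector_derivative (Suc n) f x = vector_derivative (nth_vector_derivative n f) (at x)"
  by (simp_all add: nth_vector_derivative_def)

text \<open>To differentiate once more, the previous derivative must be known near the point and not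
  only at it; hence the open set and the induction over all its points.\<close>

lemma nth_vector_derivative_eqI:
  assumes "open S" "\<And>x. x \<in> S \<Longrightarrow> f x = g 0 x"
    and "\<And>k x. k < n \<Longrightarrow> x \<in> S \<Longrightarrow> (g k has_vector_derivative g (Suc k) x) (at x)"
    and "k \<le> n" "x \<in> S"
  shows "nth_vector_derivative k f x = g k x"
  using assms(4,5)
proof (induction k arbitrary: x)
  case 0
  then show ?case using assms(2) by (simp add: nth_vector_derivative_0)
next
  case (Suc k)
  have "(g k has_vector_derivative g (Suc k) x) (at x)" using assms(3)[of k x] Suc by simp
  then have "(nth_vector_derivative k f has_vector_derivative g (Suc k) x) (at x)"
    by (rule has_vector_derivative_transform_within_open[OF _ assms(1)]) (use Suc in auto)
  then show ?case by (simp add: nth_vector_derivative_Suc vector_derivative_at)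
qed

lemma Ck_on_has_vector_derivative:
  assumes "Ck_on n f S" "k < n" "x \<in> S"
  shows "(nth_vector_derivative k f has_vector_derivative nth_vector_derivative (Suc k) f x) (at x)"
  using assms vector_derivative_works[of "nth_vector_derivative k f" "at x"]
  by (simp add: Ck_on_def nth_vector_derivative_Suc)

text \<open>Three successive derivatives of the identity \<open>g 0 s \<bullet> g 0 s = 1\<close>;
  they give the normal components of the derivatives of a spherical curve.\<close>

lemma unit_curve_derivatives:
  fixes \<gamma> :: "real \<Rightarrow> 'a::real_inner"
  assumes U: "open U" and unit: "\<And>t. t \<in> U \<Longrightarrow> norm (g 0 t) = 1"
    and d: "\<And>k t. k < 3 \<Longrightarrow> t \<in> U \<Longrightarrow> (g k has_vector_derivative g (Suc k) t) (at t)"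
    and t: "t \<in> U"
  shows "g 0 t \<bullet> g 1 t = 0" "g 0 t \<bullet> g 2 t = - (g 1 t \<bullet> g 1 t)" "g 0 t \<bullet> g 3 t = - 3 * (g 1 t \<bullet> g 2 t)"
proof -
  have zero: "f' = 0" if "\<And>s. s \<in> U \<Longrightarrow> f s = c" "(f has_real_derivative f') (at s)" "s \<in> U"
    for f :: "real \<Rightarrow> real" and c f' s
  proof -
    have "((\<lambda>_. c) has_real_derivative f') (at s)"
      using that(2) U that(3) by (rule has_field_derivative_transform_within_open) (use that(1) in simp)
    then show ?thesis by (metis DERIV_const DERIV_unique)
  qed
  have inn: "((\<lambda>s. g j s \<bullet> g k s) has_real_derivative (g j s \<bullet> g (Suc k) s + g (Suc j) s \<bullet> g k s)) (at s)"
    if "j < 3" "k < 3" "s \<in> U" for j k s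
  proof -
    have "((\<lambda>s. g j s \<bullet> g k s) has_derivative (\<lambda>h. g j s \<bullet> (h *\<^sub>R g (Suc k) s) + (h *\<^sub>R g (Suc j) s) \<bullet> g k s)) (at s)"
      using d[OF that(1,3)] d[OF that(2,3)] unfolding has_vector_derivative_def by (rule has_derivative_inner)
    then show ?thesis
      unfolding has_field_derivative_def by (rule has_derivative_eq_rhs) (auto simp: algebra_simps)
  qed
  have 1: "g 0 s \<bullet> g 1 s = 0" if "s \<in> U" for s
    using zero[of "\<lambda>s. g 0 s \<bullet> g 0 s" 1, OF _ inn[of 0 0 s]] that unit
    by (simp add: dot_square_norm inner_commute)
  have 2: "g 0 s \<bullet> g 2 s + g 1 s \<bullet> g 1 s = 0" if "s \<in> U" for s
    using zero[of "\<lambda>s. g 0 s \<bullet> g 1 s" 0, OF _ inn[of 0 1 s]] that 1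
    by (simp add: numeral_2_eq_2)
  have 3: "g 0 t \<bullet> g 3 t + 3 * (g 1 t \<bullet> g 2 t) = 0"
    using zero[of "\<lambda>s. g 0 s \<bullet> g 2 s + g 1 s \<bullet> g 1 s" 0, OF _ DERIV_add[OF inn[of 0 2 t] inn[of 1 1 t]]] t 2
    by (simp add: numeral_2_eq_2 numeral_3_eq_3 inner_commute)
  show "g 0 t \<bullet> g 1 t = 0" "g 0 t \<bullet> g 2 t = - (g 1 t \<bullet> g 1 t)" "g 0 t \<bullet> g 3 t = - 3 * (g 1 t \<bullet> g 2 t)"
    using 1[OF t] 2[OF t] 3 by auto
qed

text \<open>Chain and product rule produce many terms, but few survive where the inner function is
  stationary and the vector factor vanishes. Both conditions hold for the normal coordinate at its
  centre.\<close>

lemma derivatives_scaled_compose_at_zero: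
  fixes f0 f1 f2 f3 f4 u0 u1 u2 u3 u4 :: "real \<Rightarrow> real" and y0 y1 y2 y3 y4 g :: "real \<Rightarrow> 'a::real_normed_vector"
  assumes S: "open S" and x: "x \<in> S"
    and f: "\<And>x. x \<in> S \<Longrightarrow> (f0 has_real_derivative f1 (u0 x)) (at (u0 x))"
      "\<And>x. x \<in> S \<Longrightarrow> (f1 has_real_derivative f2 (u0 x)) (at (u0 x))"
      "\<And>x. x \<in> S \<Longrightarrow> (f2 has_real_derivative f3 (u0 x)) (at (u0 x))"
      "\<And>x. x \<in> S \<Longrightarrow> (f3 has_real_derivative f4 (u0 x)) (at (u0 x))"
    and u: "\<And>x. x \<in> S \<Longrightarrow> (u0 has_real_derivative u1 x) (at x)"
      "\<And>x. x \<in> S \<Longrightarrow> (u1 has_real_derivative u2 x) (at x)"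
      "\<And>x. x \<in> S \<Longrightarrow> (u2 has_real_derivative u3 x) (at x)"
      "\<And>x. x \<in> S \<Longrightarrow> (u3 has_real_derivative u4 x) (at x)"
    and y: "\<And>x. x \<in> S \<Longrightarrow> (y0 has_vector_derivative y1 x) (at x)"
      "\<And>x. x \<in> S \<Longrightarrow> (y1 has_vector_derivative y2 x) (at x)"
      "\<And>x. x \<in> S \<Longrightarrow> (y2 has_vector_derivative y3 x) (at x)"
      "\<And>x. x \<in> S \<Longrightarrow> (y3 has_vector_derivative y4 x) (at x)"
    and g: "\<And>x. x \<in> S \<Longrightarrow> g x = f0 (u0 x) *\<^sub>R y0 x"
    and zero: "u1 x = 0" "y0 x = 0"
  shows "nth_vector_derivative 1 g x = f0 (u0 x) *\<^sub>R y1 x"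
    and "nth_vector_derivative 2 g x = f0 (u0 x) *\<^sub>R y2 x"
    and "nth_vector_derivative 4 g x = (4 * f1 (u0 x) * u3 x) *\<^sub>R y1 x
      + (6 * f1 (u0 x) * u2 x) *\<^sub>R y2 x + f0 (u0 x) *\<^sub>R y4 x"
proof -
  \<comment> \<open>\<open>G0\<close> to \<open>G4\<close> are the derivatives of the composite, by
    the formula of Faa di Bruno.\<close>
  define G0 where "G0 x = f0 (u0 x)" for x
  define G1 where "G1 x = f1 (u0 x) * u1 x" for x
  define G2 where "G2 x = f2 (u0 x) * (u1 x)\<^sup>2 + f1 (u0 x) * u2 x" for x
  define G3 where "G3 x = f3 (u0 x) * u1 x ^ 3 + 3 * f2 (u0 x) * u1 x * u2 x + f1 (u0 x) * u3 x" for x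
  define G4 where "G4 x = f4 (u0 x) * u1 x ^ 4 + 6 * f3 (u0 x) * (u1 x)\<^sup>2 * u2 x
      + f2 (u0 x) * (3 * (u2 x)\<^sup>2 + 4 * u1 x * u3 x) + f1 (u0 x) * u4 x" for x
  have fu: "((\<lambda>x. f0 (u0 x)) has_real_derivative f1 (u0 x) * u1 x) (at x)"
    "((\<lambda>x. f1 (u0 x)) has_real_derivative f2 (u0 x) * u1 x) (at x)"
    "((\<lambda>x. f2 (u0 x)) has_real_derivative f3 (u0 x) * u1 x) (at x)"
    "((\<lambda>x. f3 (u0 x)) has_real_derivative f4 (u0 x) * u1 x) (at x)" if "x \<in> S" for x
    using that f u(1) by (auto intro: DERIV_chain2)
  have G: "(G0 has_real_derivative G1 x) (at x)" "(G1 has_real_derivative G2 x) (at x)"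
    "(G2 has_real_derivative G3 x) (at x)" "(G3 has_real_derivative G4 x) (at x)" if "x \<in> S" for x
    unfolding G0_def[abs_def] G1_def[abs_def] G2_def[abs_def] G3_def[abs_def] G4_def[abs_def]
    by (rule fu[OF that] derivative_eq_intros u[OF that] refl | simp add: power2_eq_square power3_eq_cube power4_eq_xxxx algebra_simps)+
  have scale: "((\<lambda>x. a x *\<^sub>R b x) has_vector_derivative (a' *\<^sub>R b x + a x *\<^sub>R b')) (at x)"
    if "(a has_real_derivative a') (at x)" "(b has_vector_derivative b') (at x)"
    for a :: "real \<Rightarrow> real" and b :: "real \<Rightarrow> 'a" and a' b' x
    using has_vector_derivative_scaleR[OF that] by (simp add: add.commute)
  \<comment> \<open>The Leibniz formulas, arranged as a sequence to fit
    \<open>nth_vector_derivative_eqI\<close>.\<close>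
  define P where "P = (\<lambda>k. [\<lambda>x. G0 x *\<^sub>R y0 x,
    \<lambda>x. G1 x *\<^sub>R y0 x + G0 x *\<^sub>R y1 x,
    \<lambda>x. G2 x *\<^sub>R y0 x + 2 *\<^sub>R (G1 x *\<^sub>R y1 x) + G0 x *\<^sub>R y2 x,
    \<lambda>x. G3 x *\<^sub>R y0 x + 3 *\<^sub>R (G2 x *\<^sub>R y1 x) + 3 *\<^sub>R (G1 x *\<^sub>R y2 x) + G0 x *\<^sub>R y3 x,
    \<lambda>x. G4 x *\<^sub>R y0 x + 4 *\<^sub>R (G3 x *\<^sub>R y1 x) + 6 *\<^sub>R (G2 x *\<^sub>R y2 x) + 4 *\<^sub>R (G1 x *\<^sub>R y3 x) + G0 x *\<^sub>R y4 x]
    ! k)"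
  have P: "P 0 = (\<lambda>x. G0 x *\<^sub>R y0 x)"
    "P 1 = (\<lambda>x. G1 x *\<^sub>R y0 x + G0 x *\<^sub>R y1 x)"
    "P 2 = (\<lambda>x. G2 x *\<^sub>R y0 x + 2 *\<^sub>R (G1 x *\<^sub>R y1 x) + G0 x *\<^sub>R y2 x)"
    "P 3 = (\<lambda>x. G3 x *\<^sub>R y0 x + 3 *\<^sub>R (G2 x *\<^sub>R y1 x) + 3 *\<^sub>R (G1 x *\<^sub>R y2 x) + G0 x *\<^sub>R y3 x)"
    "P 4 = (\<lambda>x. G4 x *\<^sub>R y0 x + 4 *\<^sub>R (G3 x *\<^sub>R y1 x) + 6 *\<^sub>R (G2 x *\<^sub>R y2 x) + 4 *\<^sub>R (G1 x *\<^sub>R y3 x) + G0 x *\<^sub>R y4 x)"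
    by (simp_all add: P_def)
  have sc: "2 *\<^sub>R v = v + v" "3 *\<^sub>R v = v + v + v" "4 *\<^sub>R v = v + v + v + v"
    "6 *\<^sub>R v = v + v + v + v + v + v" for v :: 'a
    using scaleR_left_distrib[of 1 1 v] scaleR_left_distrib[of 2 1 v] scaleR_left_distrib[of 3 1 v]
      scaleR_left_distrib[of 4 1 v] scaleR_left_distrib[of 5 1 v] by simp_all
  have step: "(P k has_vector_derivative P (Suc k) x) (at x)" if "k < 4" "x \<in> S" for k x
  proof -
    have "k = 0 \<or> k = 1 \<or> k = 2 \<or> k = 3" using that(1) by auto
    moreover have "(P 0 has_vector_derivative P 1 x) (at x)"
      unfolding P by (rule scale[OF G(1)[OF that(2)] y(1)[OF that(2)]])
    moreover have "(P 1 has_vector_derivative P 2 x) (at x)"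
      unfolding P
      by (rule has_vector_derivative_eq_rhs,
          (rule scale has_vector_derivative_add G[OF that(2)] y[OF that(2)])+)
        (simp add: sc add_ac del: scaleR_scaleR)
    moreover have "(P 2 has_vector_derivative P 3 x) (at x)"
      unfolding P
      by (rule has_vector_derivative_eq_rhs,
          (rule bounded_linear.has_vector_derivative[OF bounded_linear_scaleR_right] scale has_vector_derivative_add G[OF that(2)] y[OF that(2)])+)
        (simp add: sc add_ac del: scaleR_scaleR)
    moreover have "(P 3 has_vector_derivative P 4 x) (at x)"
      unfolding P
      by (rule has_vector_derivative_eq_rhs,
          (rule bounded_linear.has_vector_derivative[OF bounded_linear_scaleR_right] scale has_vector_derivative_add G[OF that(2)] y[OF that(2)])+)
        (simp add: sc add_ac del: scaleR_scaleR)
    ultimately show ?thesis by (auto simp: numeral_eq_Suc)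
  qed
  have "nth_vector_derivative k g x = P k x" if "k \<le> 4" for k
    by (rule nth_vector_derivative_eqI[of S g P 4, OF S _ step that x]) (use g in \<open>auto simp: P G0_def\<close>)
  from this[of 1] this[of 2] this[of 4]
  show "nth_vector_derivative 1 g x = f0 (u0 x) *\<^sub>R y1 x"
    "nth_vector_derivative 2 g x = f0 (u0 x) *\<^sub>R y2 x"
    "nth_vector_derivative 4 g x = (4 * f1 (u0 x) * u3 x) *\<^sub>R y1 x
      + (6 * f1 (u0 x) * u2 x) *\<^sub>R y2 x + f0 (u0 x) *\<^sub>R y4 x"
    unfolding P by (simp_all add: zero G0_def G1_def G2_def G3_def mult_ac)
qed

text \<open>The normal coordinate is F(u0) times the projected curve, where u0 = 1 - y . \<gamma>(t
  + \<eta>) has second derivative |V|^2 and third derivative 3<V,A> at 0. As F'(0) = 1/3, these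
  contribute 2|V|^2 A and 4<V,A>V to the fourth derivative.\<close>

lemma sider3_coeff_eq:
  fixes \<gamma> :: "real \<Rightarrow> real^3"
  assumes U: "open U" and unit: "\<gamma> ` U \<subseteq> sphere 0 1" and Ck: "Ck_on 5 \<gamma> U" and t: "t \<in> U"
  defines "Y \<equiv> \<lambda>k. tproj (\<gamma> t) (nth_vector_derivative k \<gamma> t)"
  shows "sider3_coeff \<gamma> t = 3 *\<^sub>R Y 4 + (2 * (norm (Y 1))\<^sup>2) *\<^sub>R Y 2 + (16 * (Y 1 \<bullet> Y 2)) *\<^sub>R Y 1"
proof -
  define g where "g k = nth_vector_derivative k \<gamma>" for k
  define y where "y = \<gamma> t"
  have g0: "g 0 = \<gamma>" by (simp add: g_def nth_vector_derivative_0)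
  have nrm: "norm (\<gamma> s) = 1" if "s \<in> U" for s using unit that by auto
  have y1: "norm y = 1" using nrm t by (simp add: y_def)
  have dg: "(g k has_vector_derivative g (Suc k) s) (at s)" if "k < 5" "s \<in> U" for k s
    using Ck_on_has_vector_derivative[OF Ck that] by (simp add: g_def)
  have on: "y \<bullet> g 1 t = 0" "y \<bullet> g 2 t = - (g 1 t \<bullet> g 1 t)" "y \<bullet> g 3 t = - 3 * (g 1 t \<bullet> g 2 t)"
    using unit_curve_derivatives[OF U, of g t] nrm dg t by (auto simp: g0 y_def)
  \<comment> \<open>Here the curve avoids the antipode of \<open>y\<close>, so the series for the
    logarithm applies.\<close>
  define S where "S = {\<eta>. t + \<eta> \<in> U \<and> -1 < y \<bullet> \<gamma> (t + \<eta>)}"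
  have "continuous_on U \<gamma>"
    using dg[of 0] unfolding g0
    by (intro continuous_at_imp_continuous_on) (auto dest: has_vector_derivative_continuous)
  then have "continuous_on U (\<lambda>s. y \<bullet> \<gamma> s)" by (intro continuous_intros)
  then have "open ((\<lambda>s. y \<bullet> \<gamma> s) -` {-1<..} \<inter> U)"
    unfolding continuous_on_open_vimage[OF U] by (elim allE[of _ "{-1<..}"]) simp
  then have "open ((\<lambda>\<eta>. t + \<eta>) -` ((\<lambda>s. y \<bullet> \<gamma> s) -` {-1<..} \<inter> U))"
    by (intro open_vimage continuous_intros)
  also have "(\<lambda>\<eta>. t + \<eta>) -` ((\<lambda>s. y \<bullet> \<gamma> s) -` {-1<..} \<inter> U) = S" by (auto simp: S_def)
  finally have S: "open S" .
  have yy: "y \<bullet> y = 1" using y1 by (simp add: dot_square_norm)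
  have S0: "0 \<in> S" using t yy by (simp add: S_def y_def)
  have dgs: "((\<lambda>\<eta>. g k (t + \<eta>)) has_vector_derivative g (Suc k) (t + \<eta>)) (at \<eta>)" if "k < 5" "\<eta> \<in> S" for k \<eta>
  proof -
    have "(g k has_vector_derivative g (Suc k) (t + \<eta>)) (at (t + \<eta>))" using dg that by (simp add: S_def)
    moreover have "((\<lambda>\<eta>. t + \<eta>) has_vector_derivative 1) (at \<eta>)"
      by (auto intro!: derivative_eq_intros)
    ultimately show ?thesis
      using vector_diff_chain_at[of "\<lambda>\<eta>. t + \<eta>" 1 \<eta> "g k"] by (simp add: o_def)
  qed
  \<comment> \<open>For k \<ge> 1, \<open>u k\<close> is the derivative of \<open>u0\<close> of
    order \<open>k\<close>; \<open>u 0\<close> differs from \<open>u0\<close> by the constant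
    1.\<close>
  define u where "u k \<eta> = - (y \<bullet> g k (t + \<eta>))" for k \<eta>
  define u0 where "u0 \<eta> = 1 - y \<bullet> \<gamma> (t + \<eta>)" for \<eta>
  define z where "z k \<eta> = tproj y (g k (t + \<eta>))" for k \<eta>
  have du: "(u k has_real_derivative u (Suc k) \<eta>) (at \<eta>)" if "k < 5" "\<eta> \<in> S" for k \<eta>
    using bounded_linear.has_vector_derivative[OF bounded_linear_minus[OF bounded_linear_inner_right] dgs[OF that], of y]
    unfolding u_def[abs_def] has_real_derivative_iff_has_vector_derivative .
  have du0: "(u0 has_real_derivative u 1 \<eta>) (at \<eta>)" if "\<eta> \<in> S" for \<eta>
    using DERIV_add[OF DERIV_const[of 1] du[of 0 \<eta>]] that by (simp add: u0_def[abs_def] u_def[abs_def] g0)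
  have dz: "(z k has_vector_derivative z (Suc k) \<eta>) (at \<eta>)" if "k < 5" "\<eta> \<in> S" for k \<eta>
    using bounded_linear.has_vector_derivative[OF bounded_linear_tproj dgs[OF that]]
    unfolding z_def[abs_def] .
  have u0_bound: "\<bar>u0 \<eta>\<bar> < 2" if "\<eta> \<in> S" for \<eta>
    using unit_inner_bounds(2)[OF y1 nrm[of "t + \<eta>"]] that by (auto simp: S_def u0_def)
  have dF: "(arc_series k has_real_derivative arc_series (Suc k) (u0 \<eta>)) (at (u0 \<eta>))" if "\<eta> \<in> S" for k \<eta>
    by (rule DERIV_arc_series[OF u0_bound[OF that]])
  have X: "normal_coord \<gamma> t \<eta> = arc_series 0 (u0 \<eta>) *\<^sub>R z 0 \<eta>" if "\<eta> \<in> S" for \<eta>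
    using sphere_log_arc_series[OF y1 nrm[of "t + \<eta>"]] that
    by (simp add: S_def u0_def z_def g0 normal_coord_def y_def)
  have at0: "u 1 0 = 0" "z 0 0 = 0" "u0 0 = 0"
    using on yy tproj_self[OF y1] by (simp_all add: u_def z_def u0_def g0 flip: y_def)
  have num: "Suc 0 = 1" "Suc 1 = 2" "Suc 2 = 3" "Suc 3 = 4" by simp_all
  note ders = derivatives_scaled_compose_at_zero[of S 0 "arc_series 0" "arc_series 1" u0 "arc_series 2" "arc_series 3"
      "arc_series 4" "u 1" "u 2" "u 3" "u 4" "z 0" "z 1" "z 2" "z 3" "z 4" "normal_coord \<gamma> t", OF S S0
      dF[of _ 0, unfolded num] dF[of _ 1, unfolded num] dF[of _ 2, unfolded num] dF[of _ 3, unfolded num]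
      du0 du[of 1, unfolded num] du[of 2, unfolded num] du[of 3, unfolded num]
      dz[of 0, unfolded num] dz[of 1, unfolded num] dz[of 2, unfolded num] dz[of 3, unfolded num] X at0(1,2)]
  have zY: "z k 0 = Y k" for k by (simp add: z_def Y_def g_def y_def)
  have Y1: "Y 1 = g 1 t" using on(1) by (simp add: Y_def tproj_def g_def y_def)
  have uY: "u 2 0 = (norm (Y 1))\<^sup>2" "u 3 0 = 3 * (Y 1 \<bullet> Y 2)"
  proof -
    show "u 2 0 = (norm (Y 1))\<^sup>2" unfolding u_def Y1 power2_norm_eq_inner using on(2) by simp
    \<comment> \<open>\<open>Y 1\<close> is tangent, so removing the normal part of
      \<open>g 2 t\<close> does not change the inner product.\<close>
    have "Y 1 \<bullet> Y 2 = g 1 t \<bullet> g 2 t"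
      using on(1) unfolding Y1 by (simp add: Y_def tproj_def g_def y_def inner_diff_right inner_commute)
    then show "u 3 0 = 3 * (Y 1 \<bullet> Y 2)" using on by (simp add: u_def)
  qed
  have nvd: "nth_vector_derivative 1 (normal_coord \<gamma> t) 0 = Y 1"
    "nth_vector_derivative 2 (normal_coord \<gamma> t) 0 = Y 2"
    "nth_vector_derivative 4 (normal_coord \<gamma> t) 0 =
      (4 * (Y 1 \<bullet> Y 2)) *\<^sub>R Y 1 + (2 * (norm (Y 1))\<^sup>2) *\<^sub>R Y 2 + Y 4"
    using ders by (simp_all add: at0 zY arc_series_zero uY)
  show ?thesis
    unfolding sider3_coeff_def Let_def nvd by (simp add: vec_eq_iff algebra_simps)
qed

subsection \<open>The SIDER reconstructions\<close>

context sphere_expansion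
begin

text \<open>The point extrapolated from \<open>p2\<close> through \<open>p1\<close> has the same
  linear coefficient as \<open>p0\<close>, and the one from \<open>p0\<close> through
  \<open>p1\<close> the same as \<open>p2\<close>. Hence the two middle SLERPs receive no cubic
  correction; it arises only from the doublings and the outermost SLERP. The coefficient
  -u(u-1)(u-2)/6 of \<open>B\<close> is the error of ordinary quadratic interpolation.\<close>

lemma has_jet_quadratic:
  fixes u :: "'p \<Rightarrow> real"
  assumes u: "ord 0 u"
    and p0: "has_jet p0 (\<lambda>x. - u x) (\<lambda>x. (- u x)\<^sup>2 / 2) (\<lambda>x. (- u x) ^ 3 / 6) (\<lambda>x. (- u x) ^ 4 / 24)
      (\<lambda>_. 0) (\<lambda>_. 0) (\<lambda>_. 0)"
    and p1: "has_jet p1 (\<lambda>x. 1 - u x) (\<lambda>x. (1 - u x)\<^sup>2 / 2) (\<lambda>x. (1 - u x) ^ 3 / 6) (\<lambda>x. (1 - u x) ^ 4 / 24)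
      (\<lambda>_. 0) (\<lambda>_. 0) (\<lambda>_. 0)"
    and p2: "has_jet p2 (\<lambda>x. 2 - u x) (\<lambda>x. (2 - u x)\<^sup>2 / 2) (\<lambda>x. (2 - u x) ^ 3 / 6) (\<lambda>x. (2 - u x) ^ 4 / 24)
      (\<lambda>_. 0) (\<lambda>_. 0) (\<lambda>_. 0)"
  shows "has_jet (\<lambda>x. slerp (slerp (p0 x) (slerp (p2 x) (p1 x) 2) (u x / 2))
        (slerp (slerp (p0 x) (p1 x) 2) (p2 x) (u x / 2)) (u x / 2))
     (\<lambda>_. 0) (\<lambda>_. 0)
     (\<lambda>x. - (u x * (u x - 1) * (u x - 2)) / 6)
     (\<lambda>x. u x * (u x - 1)\<^sup>2 * (u x - 2) / 8)
     (\<lambda>x. - (u x * (u x - 1) * (u x - 2)) / 6)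
     (\<lambda>x. u x * (u x - 1)\<^sup>2 * (u x - 2) / 12)
     (\<lambda>x. 2 * (u x * (u x - 1)\<^sup>2 * (u x - 2)) / 3)"
proof -
  have two: "ord 0 (\<lambda>_. 2 :: real)" and u2: "ord 0 (\<lambda>x. u x / 2)"
    by (intro ord_zero_intros u)+
  have da: "has_jet (\<lambda>x. slerp (p2 x) (p1 x) 2)
     (\<lambda>x. - u x) (\<lambda>x. (u x)\<^sup>2 / 2 - 1) (\<lambda>x. - (u x ^ 3 / 6) + u x - 1)
     (\<lambda>x. u x ^ 4 / 24 - (u x)\<^sup>2 / 2 + u x - 7 / 12)
     (\<lambda>x. u x - 1) (\<lambda>x. - (u x - 1)\<^sup>2 / 2) (\<lambda>x. (u x - 1) * (3 - 2 * u x))"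
    by (rule has_jet_slerp[OF p2 p1 two]) (simp_all add: field_simps eval_nat_numeral)
  have db: "has_jet (\<lambda>x. slerp (p0 x) (p1 x) 2)
     (\<lambda>x. 2 - u x) (\<lambda>x. (u x)\<^sup>2 / 2 - 2 * u x + 1) (\<lambda>x. - (u x ^ 3 / 6) + (u x)\<^sup>2 - u x + 1 / 3)
     (\<lambda>x. u x ^ 4 / 24 - u x ^ 3 / 3 + (u x)\<^sup>2 / 2 - u x / 3 + 1 / 12)
     (\<lambda>x. u x - 1) (\<lambda>x. - (u x - 1)\<^sup>2 / 2) (\<lambda>x. (u x - 1) * (1 - 2 * u x))"
    by (rule has_jet_slerp[OF p0 p1 two]) (simp_all add: field_simps eval_nat_numeral)
  have qa: "has_jet (\<lambda>x. slerp (p0 x) (slerp (p2 x) (p1 x) 2) (u x / 2))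
     (\<lambda>x. - u x) (\<lambda>x. u x * (u x - 1) / 2) (\<lambda>x. - (u x * ((u x)\<^sup>2 - 3 * u x + 3)) / 6)
     (\<lambda>x. u x * (u x - 1) * ((u x)\<^sup>2 - 5 * u x + 7) / 24)
     (\<lambda>x. u x * (u x - 1) / 2) (\<lambda>x. - (u x * (u x - 1)\<^sup>2) / 4) (\<lambda>x. u x * (u x - 1) * (3 / 2 - u x))"
    by (rule has_jet_slerp[OF p0 da u2]) (simp_all add: field_simps eval_nat_numeral)
  have qb: "has_jet (\<lambda>x. slerp (slerp (p0 x) (p1 x) 2) (p2 x) (u x / 2))
     (\<lambda>x. 2 - u x) (\<lambda>x. (u x - 1) * (u x - 2) / 2) (\<lambda>x. - ((u x - 2) * ((u x)\<^sup>2 - u x + 1)) / 6)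
     (\<lambda>x. (u x - 1) * (u x - 2) * ((u x)\<^sup>2 + u x + 1) / 24)
     (\<lambda>x. - ((u x - 1) * (u x - 2)) / 2) (\<lambda>x. (u x - 1)\<^sup>2 * (u x - 2) / 4)
     (\<lambda>x. (u x - 1) * (u x - 2) * (u x - 1 / 2))"
    by (rule has_jet_slerp[OF db p2 u2]) (simp_all add: field_simps eval_nat_numeral)
  show ?thesis
    by (rule has_jet_slerp[OF qa qb u2]) (simp_all add: field_simps eval_nat_numeral)
qed

text \<open>The linear coefficients vanish, so SLERP acts as linear interpolation, and as in
  Neville's scheme the weights 1 - u/3 and u/3 cancel the cubic terms of the two stencils. The
  polynomials \<open>a4\<close>, \<open>c2\<close>, \<open>c3\<close> are in ratio 3 : 2 : 16, so
  one computation gives all three remaining coefficients.\<close>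

lemma has_jet_cubic:
  fixes u :: "'p \<Rightarrow> real"
  defines "a3 \<equiv> \<lambda>v. - (v * (v - 1) * (v - 2)) / 6 :: real" and "a4 \<equiv> \<lambda>v. v * (v - 1)\<^sup>2 * (v - 2) / 8 :: real"
    and "c2 \<equiv> \<lambda>v. v * (v - 1)\<^sup>2 * (v - 2) / 12 :: real" and "c3 \<equiv> \<lambda>v. 2 * (v * (v - 1)\<^sup>2 * (v - 2)) / 3 :: real"
    and "q \<equiv> \<lambda>v. v * (v - 1) * (v - 2) * (v - 3) :: real"
  assumes u: "ord 0 u"
    and a: "has_jet a (\<lambda>_. 0) (\<lambda>_. 0) (\<lambda>x. a3 (u x)) (\<lambda>x. a4 (u x)) (\<lambda>x. a3 (u x)) (\<lambda>x. c2 (u x)) (\<lambda>x. c3 (u x))"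
    and b: "has_jet b (\<lambda>_. 0) (\<lambda>_. 0) (\<lambda>x. a3 (u x - 1)) (\<lambda>x. a4 (u x - 1)) (\<lambda>x. a3 (u x - 1))
      (\<lambda>x. c2 (u x - 1)) (\<lambda>x. c3 (u x - 1))"
  shows "has_jet (\<lambda>x. slerp (a x) (b x) (u x / 3)) (\<lambda>_. 0) (\<lambda>_. 0) (\<lambda>_. 0) (\<lambda>x. - q (u x) / 24)
     (\<lambda>_. 0) (\<lambda>x. - q (u x) / 36) (\<lambda>x. - 2 * q (u x) / 9)"
  by (rule has_jet_slerp[OF a b])
    (auto intro!: ord_zero_intros u simp: a3_def a4_def c2_def c3_def q_def field_simps eval_nat_numeral)

text \<open>The projection is already O(h^4), so it is enough that the scalar factor of the
  logarithm is 1 + O(h).\<close>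

lemma sphere_log_jet:
  assumes "has_jet P (\<lambda>_. 0) (\<lambda>_. 0) (\<lambda>_. 0) a4 (\<lambda>_. 0) c2 c3"
  shows "ord 5 (\<lambda>x. sphere_log (y x) (P x)
     - h x ^ 4 *\<^sub>R (a4 x *\<^sub>R E x + (c2 x * (norm (V x))\<^sup>2) *\<^sub>R A x + (c3 x * (V x \<bullet> A x)) *\<^sub>R V x))"
proof -
  let ?J = "\<lambda>x. h x ^ 4 *\<^sub>R (a4 x *\<^sub>R E x + (c2 x * (norm (V x))\<^sup>2) *\<^sub>R A x + (c3 x * (V x \<bullet> A x)) *\<^sub>R V x)"
  let ?w = "\<lambda>x. 1 - y x \<bullet> P x"
  have P1: "\<forall>\<^sub>F x in F. norm (P x) = 1" and Py: "ord 1 (\<lambda>x. P x - y x)"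
    and j: "ord 5 (\<lambda>x. tproj (y x) (P x) - jet (\<lambda>_. 0) (\<lambda>_. 0) (\<lambda>_. 0) a4 (\<lambda>_. 0) c2 c3 x)"
    and o: "ord 0 a4" "ord 0 c2" "ord 0 c3"
    using assms by (auto simp: has_jet_def)
  have J: "ord 5 (\<lambda>x. tproj (y x) (P x) - ?J x)"
    by (rule ord_cong[OF j]) (simp add: jet_def algebra_simps)
  have "ord 0 (\<lambda>x. a4 x *\<^sub>R E x + (c2 x * (norm (V x))\<^sup>2) *\<^sub>R A x + (c3 x * (V x \<bullet> A x)) *\<^sub>R V x)"
    by (intro ord_add ord_scaleR0 ord_zero_intros(4) o ord_VV ord_VA ord_A ord_V ord_E)
  from ord_scaleR[OF ord_h_power[of 4] this] have J4: "ord 4 ?J" by simp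
  have T4: "ord 4 (\<lambda>x. tproj (y x) (P x))"
    using ord_add[OF ord_mono[OF J, of 4] J4] by simp
  have w: "ord 1 ?w"
  proof (rule ord_cong)
    show "ord 1 (\<lambda>x. (P x - y x) \<bullet> (P x - y x) / 2)"
      using ord_mono[OF ord_mult[OF ord_inner[OF Py Py] ord_const[of "1 / 2"]], of 1] by simp
    show "\<forall>\<^sub>F x in F. ?w x = (P x - y x) \<bullet> (P x - y x) / 2"
      using P1 y_unit
    proof eventually_elim
      case (elim x)
      show ?case
        using unit_inner_eq[OF elim(2,1)]
        by (simp add: norm_minus_commute[of "y x"] flip: power2_norm_eq_inner)
    qed
  qed
  have "((\<lambda>v. (arc_series 0 v - arc_series 0 0) / (v - 0)) \<longlongrightarrow> arc_series (Suc 0) 0) (at 0)"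
    using DERIV_arc_series[of 0 0] unfolding has_field_derivative_iff by simp
  then have "((\<lambda>v. (arc_series 0 v - 1) / v) \<longlongrightarrow> 1 / 3) (at 0)"
    by (simp only: arc_series_zero diff_zero)
  \<comment> \<open>The slope at 0 is 1/3, so near 0 the factor differs from 1 by at most
    \<open>\<bar>v\<bar>\<close>.\<close>
  then have "\<forall>\<^sub>F v in at 0. \<bar>(arc_series 0 v - 1) / v\<bar> < 1"
    using order_tendstoD(2)[OF tendsto_rabs, of _ "1/3" _ 1] by force
  then obtain e where e: "e > 0" "\<And>v. v \<noteq> 0 \<Longrightarrow> \<bar>v\<bar> < e \<Longrightarrow> \<bar>(arc_series 0 v - 1) / v\<bar> < 1"
    unfolding eventually_at by (auto simp: dist_norm)
  have lip: "\<bar>arc_series 0 v - 1\<bar> \<le> \<bar>v\<bar>" if "\<bar>v\<bar> < e" for v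
    using e(2)[of v] that by (cases "v = 0") (auto simp: arc_series_zero abs_divide field_simps)
  have F1: "ord 1 (\<lambda>x. arc_series 0 (?w x) - 1)"
  proof (rule ord_bound[OF w])
    show "\<forall>\<^sub>F x in F. norm (arc_series 0 (?w x) - 1) \<le> norm (?w x)"
      using ord_eventually_less[OF w e(1)] by eventually_elim (use lip in simp)
  qed
  have "ord 5 (\<lambda>x. (arc_series 0 (?w x) - 1) *\<^sub>R tproj (y x) (P x) + (tproj (y x) (P x) - ?J x))"
    using ord_add[OF ord_scaleR[OF F1 T4], of "\<lambda>x. tproj (y x) (P x) - ?J x"] J by simp
  then show ?thesis
  proof (rule ord_cong)
    show "\<forall>\<^sub>F x in F. sphere_log (y x) (P x) - ?J x =
        (arc_series 0 (?w x) - 1) *\<^sub>R tproj (y x) (P x) + (tproj (y x) (P x) - ?J x)"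
      \<comment> \<open>\<open>?w x < 1\<close> makes the inner product of \<open>y x\<close> and
        \<open>P x\<close> positive, which excludes the antipode.\<close>
      using y_unit P1 ord_eventually_less[OF w, of 1, simplified]
      by eventually_elim (auto simp: sphere_log_arc_series scaleR_diff_left abs_less_iff)
  qed
qed

end

text \<open>Induction on \<open>n\<close>: the derivative of the remainder of \<open>f 0\<close> is
  the remainder of \<open>f 1\<close> of one order less, and the mean value inequality on the
  segment from \<open>t\<close> to \<open>s\<close> supplies one more factor
  \<open>\<bar>s - t\<bar>\<close>. The factor 1/n! is given up.\<close>

lemma vector_taylor_bound:
  fixes f :: "nat \<Rightarrow> real \<Rightarrow> 'a::real_normed_vector"
  assumes I: "convex I" and t: "t \<in> I"
    and "\<And>k x. k < n \<Longrightarrow> x \<in> I \<Longrightarrow> (f k has_vector_derivative f (Suc k) x) (at x)"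
    and "\<And>x. x \<in> I \<Longrightarrow> norm (f n x) \<le> M" and "s \<in> I"
  shows "norm (f 0 s - (\<Sum>k<n. ((s - t) ^ k / fact k) *\<^sub>R f k t)) \<le> M * \<bar>s - t\<bar> ^ n"
  using assms(3-)
proof (induction n arbitrary: f s)
  case 0
  then show ?case by simp
next
  case (Suc n)
  define g where "g x = f 0 x - (\<Sum>k<Suc n. ((x - t) ^ k / fact k) *\<^sub>R f k t)" for x
  define g' where "g' x = f 1 x - (\<Sum>k<n. ((x - t) ^ k / fact k) *\<^sub>R f (Suc k) t)" for x
  have gd: "(g has_vector_derivative g' x) (at x)" if "x \<in> I" for x
  proof -
    have g_eq: "g = (\<lambda>x. f 0 x - f 0 t - (\<Sum>k<n. ((x - t) ^ Suc k / fact (Suc k)) *\<^sub>R f (Suc k) t))"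
      by (rule ext) (simp only: g_def sum.lessThan_Suc_shift, simp)
    have summand: "((\<lambda>x. ((x - t) ^ Suc k / fact (Suc k)) *\<^sub>R f (Suc k) t) has_vector_derivative
        ((x - t) ^ k / fact k) *\<^sub>R f (Suc k) t) (at x)" for k
    proof -
      have "((\<lambda>x. (x - t) ^ Suc k / fact (Suc k)) has_real_derivative (x - t) ^ k / fact k) (at x)"
        using DERIV_cdivide[OF DERIV_power[OF DERIV_diff[OF DERIV_ident DERIV_const[of t]], where n = "Suc k"],
            where c = "fact (Suc k)"] by (simp add: divide_simps mult_ac)
      from has_vector_derivative_scaleR[OF this has_vector_derivative_const]
      show ?thesis by simp
    qed
    have f0: "(f 0 has_vector_derivative f 1 x) (at x)" using Suc.prems(1)[of 0 x] that by simp
    have "(g has_vector_derivative (f 1 x - 0 - (\<Sum>k<n. ((x - t) ^ k / fact k) *\<^sub>R f (Suc k) t))) (at x)"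
      unfolding g_eq
      by (intro has_vector_derivative_diff has_vector_derivative_sum has_vector_derivative_const summand f0)
    then show ?thesis by (simp add: g'_def)
  qed
  have g'b: "norm (g' x) \<le> M * \<bar>x - t\<bar> ^ n" if "x \<in> I" for x
    using Suc.IH[of "\<lambda>k. f (Suc k)" x] Suc.prems that by (simp add: g'_def)
  have M0: "0 \<le> M" using Suc.prems(2)[OF t] norm_ge_zero order_trans by blast
  let ?S = "closed_segment t s"
  have sub: "?S \<subseteq> I" using closed_segment_subset[OF t Suc.prems(3) I] .
  have "norm (g s - g t) \<le> (M * \<bar>s - t\<bar> ^ n) * norm (s - t)"
  proof (rule differentiable_bound[of ?S g "\<lambda>x h. h *\<^sub>R g' x"])
    fix x assume x: "x \<in> ?S"
    then show "(g has_derivative (\<lambda>h. h *\<^sub>R g' x)) (at x within ?S)"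
      using gd[of x] sub unfolding has_vector_derivative_def by (auto intro: has_derivative_at_withinI)
    have "\<bar>x - t\<bar> \<le> \<bar>s - t\<bar>" using x by (auto simp: closed_segment_eq_real_ivl split: if_splits)
    then have "M * \<bar>x - t\<bar> ^ n \<le> M * \<bar>s - t\<bar> ^ n"
      using M0 by (intro mult_left_mono power_mono) auto
    then have "norm (g' x) \<le> M * \<bar>s - t\<bar> ^ n" using g'b[of x] x sub by force
    then show "onorm (\<lambda>h. h *\<^sub>R g' x) \<le> M * \<bar>s - t\<bar> ^ n"
      by (intro onorm_le) (simp add: mult.commute mult_left_mono)
  qed auto
  moreover have "g t = 0" by (simp only: g_def sum.lessThan_Suc_shift) simp
  ultimately show ?case by (simp add: g_def mult_ac)
qed


section \<open>Tangency of the coefficient and the uniform estimate\<close>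

lemma sider3_coeff_tangent:
  fixes \<gamma> :: "real \<Rightarrow> real^3"
  assumes "open U" "\<gamma> ` U \<subseteq> sphere 0 1" "Ck_on 5 \<gamma> U" "t \<in> U"
  shows "sider3_coeff \<gamma> t \<in> tangent_space_S2 (\<gamma> t)"
proof -
  have "norm (\<gamma> t) = 1" using assms(2,4) by auto
  then show ?thesis
    unfolding sider3_coeff_eq[OF assms] tangent_space_S2_def
    by (simp add: inner_add_left tproj_inner_base)
qed

theorem proposition3:
  fixes \<gamma> :: "real \<Rightarrow> real^3" and K0 U :: "real set" and i :: int and h0 M :: real
  assumes "is_interval K0" and "bounded K0"
    and "open U" and "h0 > 0"
    and "\<And>\<theta> h. \<theta> \<in> K0 \<Longrightarrow> 0 \<le> h \<Longrightarrow> h \<le> h0 \<Longrightarrow> \<theta> * h \<in> U"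
    and "\<gamma> ` U \<subseteq> sphere 0 1" and "Ck_on 5 \<gamma> U"
    and "\<forall>\<^sub>F h in at_right 0. \<exists>c\<in>sphere 0 1. \<exists>r \<le> M * h.
           geodesically_convex (geodesic_ball c r) \<and>
           (\<forall>\<theta>\<in>K0. sider3_points \<gamma> i \<theta> h \<subseteq> geodesic_ball c r)"
  shows "\<exists>C. \<forall>\<^sub>F h in at_right 0. \<forall>\<theta>\<in>K0.
           sider3_coeff \<gamma> (\<theta> * h) \<in> tangent_space_S2 (\<gamma> (\<theta> * h)) \<and>
           norm (sphere_log (\<gamma> (\<theta> * h)) (sider3 \<gamma> i \<theta> h)
                 - (- (h ^ 4 / 72) * (\<Prod>j=i..i + 3. \<theta> - of_int j)) *\<^sub>R sider3_coeff \<gamma> (\<theta> * h))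
             \<le> C * h ^ 5"
\<comment> \<open>An element of \<open>K0\<close> places 0 in \<open>U\<close>, through the case
  \<open>h = 0\<close> of the hypothesis; for empty \<open>K0\<close> the claim is vacuous.\<close>
proof (cases "K0 = {}")
  case True
  then show ?thesis by simp
next
  case False
  then obtain \<theta>0 where "\<theta>0 \<in> K0" by blast
  then have "0 \<in> U" using assms(5)[of \<theta>0 0] assms(4) by simp
  then obtain \<epsilon> where \<epsilon>: "\<epsilon> > 0" "cball 0 \<epsilon> \<subseteq> U" using assms(3) open_contains_cball by blast
  define I where "I = cball (0::real) \<epsilon>"
  have I: "convex I" "compact I" "I \<subseteq> U" using \<epsilon> by (auto simp: I_def)
  define g where "g k = nth_vector_derivative k \<gamma>" for k
  have g0: "g 0 = \<gamma>" by (simp add: g_def nth_vector_derivative_0)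
  have dg: "(g k has_vector_derivative g (Suc k) s) (at s)" if "k < 5" "s \<in> I" for k s
    using Ck_on_has_vector_derivative[OF assms(7) that(1), of s] that(2) I(3) by (auto simp: g_def)
  have unit: "norm (\<gamma> s) = 1" if "s \<in> I" for s using assms(6) that I(3) by (simp add: image_subset_iff subset_iff)
  \<comment> \<open>Compactness bounds the derivatives; order 5 is treated separately because its
    continuity is assumed and does not come from differentiability.\<close>
  have "\<exists>C. \<forall>s\<in>I. norm (g k s) \<le> C" if "k \<le> 5" for k
  proof -
    have "continuous_on I (g k)"
    proof (cases "k = 5")
      case True
      then show ?thesis using assms(7) continuous_on_subset[OF _ I(3)] by (auto simp: Ck_on_def g_def)
    next
      case False
      then show ?thesis
        using dg[of k] that by (intro continuous_at_imp_continuous_on) (auto dest: has_vector_derivative_continuous)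
    qed
    then have "bounded (g k ` I)" using I(2) by (intro compact_imp_bounded compact_continuous_image)
    then show ?thesis by (auto simp: bounded_iff)
  qed
  then obtain C where C: "norm (g k s) \<le> C k" if "k \<le> 5" "s \<in> I" for k s by metis
  \<comment> \<open>Along this product, a property holds eventually iff for all small h > 0 it holds
    for every \<theta> in \<open>K0\<close>; this is the required uniformity.\<close>
  define F where "F = principal K0 \<times>\<^sub>F at_right (0::real)"
  have Fh: "filterlim snd (at_right 0) F" and FK: "filterlim fst (principal K0) F"
    unfolding F_def by (rule filterlim_snd filterlim_fst)+
  interpret small_parameter F snd
  proof
    show "(snd \<longlongrightarrow> 0) F"
      using filterlim_mono[OF Fh _ order_refl, of "nhds 0"] by (simp add: at_within_def)
    show "\<forall>\<^sub>F p in F. 0 < snd p"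
      using Fh eventually_at_right_less[of "0::real"] unfolding filterlim_iff by blast
  qed
  obtain b where b: "\<bar>\<theta>\<bar> \<le> b" if "\<theta> \<in> K0" for \<theta> using assms(2) unfolding bounded_real by blast
  have "\<forall>\<^sub>F p in F. fst p \<in> K0" using FK by (simp add: filterlim_principal)
  then have \<theta>: "ord 0 fst" by (intro ordI[of _ b]) (auto elim!: eventually_mono intro: b)
  define s where "s p = fst p * snd p" for p :: "real \<times> real"
  have "ord 1 s" using ord_mult[OF \<theta> ord_h] by (simp add: s_def[abs_def])
  from ord_eventually_less[OF this \<epsilon>(1)]
  have sI: "\<forall>\<^sub>F p in F. s p \<in> I"
    by eventually_elim (simp add: I_def)
  have nI: "\<forall>\<^sub>F p in F. of_int j * snd p \<in> I" for j
  proof -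
    have "ord 1 (\<lambda>p. of_int j * snd p)" using ord_mult[OF ord_const[of "of_int j"] ord_h] by simp
    from ord_eventually_less[OF this \<epsilon>(1)] show ?thesis by eventually_elim (simp add: I_def)
  qed
  define Y where "Y k p = tproj (\<gamma> (s p)) (g k (s p))" for k p
  have Y0: "ord 0 (Y k)" if "k \<le> 5" for k
  proof (rule ordI)
    show "\<forall>\<^sub>F p in F. norm (Y k p) \<le> C k * snd p ^ 0"
      using sI by eventually_elim
        (use norm_tproj_le[OF unit] C[OF that] in \<open>auto simp: Y_def intro: order_trans\<close>)
  qed
  interpret sphere_expansion F snd "\<lambda>p. \<gamma> (s p)" "Y 1" "Y 2" "Y 3" "Y 4"
    by unfold_locales (use sI unit Y0 in \<open>auto elim!: eventually_mono\<close>)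
  \<comment> \<open>Taylor expansion at \<open>s p\<close> with increment (j - \<theta>)h. The
    projection kills the term of order 0, so the jet starts with \<open>V\<close>.\<close>
  have nodes: "has_jet (\<lambda>p. node \<gamma> (snd p) j) a1 a2 a3 a4 (\<lambda>_. 0) (\<lambda>_. 0) (\<lambda>_. 0)"
    if a: "\<And>p. a1 p = of_int j - fst p" "\<And>p. a2 p = (a1 p)\<^sup>2 / 2" "\<And>p. a3 p = a1 p ^ 3 / 6" "\<And>p. a4 p = a1 p ^ 4 / 24"
    for j a1 a2 a3 a4
  proof -
    have a1: "ord 0 a1" unfolding a(1)[abs_def] by (intro ord_zero_intros \<theta>)
    have o: "ord 0 a2" "ord 0 a3" "ord 0 a4"
      unfolding a(2-4)[abs_def] by (intro ord_zero_intros a1)+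
    have d: "of_int j * snd p - s p = a1 p * snd p" for p
      by (simp add: s_def a(1) algebra_simps)
    have od: "ord n (\<lambda>p. c * \<bar>a1 p * snd p\<bar> ^ n)" for c n
    proof (rule ord_cong)
      show "ord n (\<lambda>p. c * \<bar>a1 p\<bar> ^ n * snd p ^ n)"
        using ord_mult[OF ord_zero_intros(4)[OF ord_zero_intros(7)[of c] ord_zero_intros(5)[OF ord_norm[OF a1], of n]]
            ord_h_power[of n]] by simp
      show "\<forall>\<^sub>F p in F. c * \<bar>a1 p * snd p\<bar> ^ n = c * \<bar>a1 p\<bar> ^ n * snd p ^ n"
        using h_pos by eventually_elim (simp add: abs_mult power_mult_distrib)
    qed
    have "\<forall>\<^sub>F p in F. norm (node \<gamma> (snd p) j) = 1"
      using nI[of j] by eventually_elim (simp add: node_def unit)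
    moreover have "ord 1 (\<lambda>p. node \<gamma> (snd p) j - \<gamma> (s p))"
    proof (rule ord_bound[OF od[of 1 "C 1"]])
      show "\<forall>\<^sub>F p in F. norm (node \<gamma> (snd p) j - \<gamma> (s p)) \<le> norm (C 1 * \<bar>a1 p * snd p\<bar> ^ 1)"
        using nI[of j] sI
      proof eventually_elim
        case (elim p)
        have "norm (g 0 (of_int j * snd p) - (\<Sum>k<1. ((of_int j * snd p - s p) ^ k / fact k) *\<^sub>R g k (s p)))
            \<le> C 1 * \<bar>of_int j * snd p - s p\<bar> ^ 1"
          by (rule vector_taylor_bound[OF I(1) elim(2)]) (use dg C elim(1) in auto)
        then have "norm (node \<gamma> (snd p) j - \<gamma> (s p)) \<le> C 1 * \<bar>a1 p * snd p\<bar> ^ 1"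
          by (simp add: node_def g0 d)
        then show ?case unfolding real_norm_def by (rule order_trans[OF _ abs_ge_self])
      qed
    qed
    moreover have "ord 5 (\<lambda>p. tproj (\<gamma> (s p)) (node \<gamma> (snd p) j) - jet a1 a2 a3 a4 (\<lambda>_. 0) (\<lambda>_. 0) (\<lambda>_. 0) p)"
    proof (rule ord_bound[OF od[of 5 "C 5"]])
      show "\<forall>\<^sub>F p in F. norm (tproj (\<gamma> (s p)) (node \<gamma> (snd p) j) - jet a1 a2 a3 a4 (\<lambda>_. 0) (\<lambda>_. 0) (\<lambda>_. 0) p)
          \<le> norm (C 5 * \<bar>a1 p * snd p\<bar> ^ 5)"
        using nI[of j] sI
      proof eventually_elim
        case (elim p)
        let ?x = "a1 p * snd p"
        have five: "{..<5} = {0, 1, 2, 3, 4::nat}" by auto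
        have y: "norm (\<gamma> (s p)) = 1" using unit[OF elim(2)] .
        define R where "R = g 0 (of_int j * snd p) - (\<Sum>k<5. (?x ^ k / fact k) *\<^sub>R g k (s p))"
        have "norm R \<le> C 5 * \<bar>?x\<bar> ^ 5"
          unfolding R_def d[symmetric]
          by (rule vector_taylor_bound[OF I(1) elim(2)]) (use dg C elim(1) in auto)
        moreover have "tproj (\<gamma> (s p)) (node \<gamma> (snd p) j) - jet a1 a2 a3 a4 (\<lambda>_. 0) (\<lambda>_. 0) (\<lambda>_. 0) p
            = tproj (\<gamma> (s p)) R"
          unfolding R_def five jet_def
          by (simp add: tproj_diff tproj_add tproj_scaleR g0 tproj_self[OF y] node_def Y_def
              a(2-4) fact_numeral power_mult_distrib mult_ac)
        ultimately have "norm (tproj (\<gamma> (s p)) (node \<gamma> (snd p) j) - jet a1 a2 a3 a4 (\<lambda>_. 0) (\<lambda>_. 0) (\<lambda>_. 0) p)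
            \<le> C 5 * \<bar>?x\<bar> ^ 5" using norm_tproj_le[OF y, of R] by simp
        then show ?case unfolding real_norm_def by (rule order_trans[OF _ abs_ge_self])
      qed
    qed
    ultimately show ?thesis unfolding has_jet_def using a1 o by (simp add: ord_const)
  qed
  have quadratic: "has_jet (\<lambda>p. sider2 \<gamma> l (fst p) (snd p)) (\<lambda>_. 0) (\<lambda>_. 0)
     (\<lambda>p. - (v p * (v p - 1) * (v p - 2)) / 6)
     (\<lambda>p. v p * (v p - 1)\<^sup>2 * (v p - 2) / 8)
     (\<lambda>p. - (v p * (v p - 1) * (v p - 2)) / 6)
     (\<lambda>p. v p * (v p - 1)\<^sup>2 * (v p - 2) / 12)
     (\<lambda>p. 2 * (v p * (v p - 1)\<^sup>2 * (v p - 2)) / 3)"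
    if v: "\<And>p. v p = fst p - of_int l" for l v
  proof -
    have vo: "ord 0 v" unfolding v[abs_def] by (intro ord_zero_intros \<theta>)
    show ?thesis
      unfolding sider2_def sider_qa_def sider_qb_def sider_da_def sider_db_def v[symmetric]
      by (intro has_jet_quadratic nodes vo) (simp_all add: v)
  qed
  define u where "u p = fst p - of_int i" for p :: "real \<times> real"
  define q where "q v = v * (v - 1) * (v - 2) * (v - 3)" for v :: real
  have u: "ord 0 u" unfolding u_def[abs_def] by (intro ord_zero_intros \<theta>)
  \<comment> \<open>The second stencil starts at \<open>i + 1\<close> and therefore sees
    \<open>u p - 1\<close>.\<close>
  have "has_jet (\<lambda>p. sider3 \<gamma> i (fst p) (snd p)) (\<lambda>_. 0) (\<lambda>_. 0) (\<lambda>_. 0) (\<lambda>p. - q (u p) / 24)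
     (\<lambda>_. 0) (\<lambda>p. - q (u p) / 36) (\<lambda>p. - 2 * q (u p) / 9)"
    unfolding sider3_def q_def u_def[symmetric]
    by (rule has_jet_cubic[OF u quadratic[of u i] quadratic[of "\<lambda>p. u p - 1" "i + 1"]])
      (simp_all add: u_def)
  note sphere_log_jet[OF this]
  \<comment> \<open>The coefficients 3, 2, 16 of \<open>sider3_coeff_eq\<close>, multiplied by
    -q/72, are -q/24, -q/36 and -2q/9.\<close>
  moreover have "\<forall>\<^sub>F p in F. sphere_log (\<gamma> (s p)) (sider3 \<gamma> i (fst p) (snd p))
      - (- (snd p ^ 4 / 72) * (\<Prod>j=i..i + 3. fst p - of_int j)) *\<^sub>R sider3_coeff \<gamma> (s p)
    = sphere_log (\<gamma> (s p)) (sider3 \<gamma> i (fst p) (snd p))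
      - snd p ^ 4 *\<^sub>R ((- q (u p) / 24) *\<^sub>R Y 4 p + (- q (u p) / 36 * (norm (Y 1 p))\<^sup>2) *\<^sub>R Y 2 p
        + (- 2 * q (u p) / 9 * (Y 1 p \<bullet> Y 2 p)) *\<^sub>R Y 1 p)"
    using sI
  proof eventually_elim
    case (elim p)
    have "{i..i + 3} = {i, i + 1, i + 2, i + 3}" by auto
    then have P: "(\<Prod>j=i..i + 3. fst p - of_int j) = q (u p)"
      by (simp add: q_def u_def algebra_simps)
    have K: "sider3_coeff \<gamma> (s p) = 3 *\<^sub>R Y 4 p + (2 * (norm (Y 1 p))\<^sup>2) *\<^sub>R Y 2 p + (16 * (Y 1 p \<bullet> Y 2 p)) *\<^sub>R Y 1 p"
      using sider3_coeff_eq[OF assms(3,6,7)] elim I(3) by (auto simp: Y_def g_def)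
    show ?case unfolding P K by (simp add: vec_eq_iff algebra_simps)
  qed
  ultimately have "ord 5 (\<lambda>p. sphere_log (\<gamma> (s p)) (sider3 \<gamma> i (fst p) (snd p))
      - (- (snd p ^ 4 / 72) * (\<Prod>j=i..i + 3. fst p - of_int j)) *\<^sub>R sider3_coeff \<gamma> (s p))"
    by (rule ord_cong)
  then obtain D where D: "\<forall>\<^sub>F p in F. norm (sphere_log (\<gamma> (s p)) (sider3 \<gamma> i (fst p) (snd p))
      - (- (snd p ^ 4 / 72) * (\<Prod>j=i..i + 3. fst p - of_int j)) *\<^sub>R sider3_coeff \<gamma> (s p)) \<le> D * snd p ^ 5"
    by (auto simp: ord_def)
  have "\<forall>\<^sub>F p in F. sider3_coeff \<gamma> (s p) \<in> tangent_space_S2 (\<gamma> (s p))"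
    using sI by eventually_elim (use sider3_coeff_tangent[OF assms(3,6,7)] I(3) in auto)
  from eventually_conj[OF this D] show ?thesis
    unfolding F_def eventually_prod_filter eventually_principal
    by (elim exE conjE, intro exI[of _ D]) (auto simp: s_def elim!: eventually_mono)
qed

end
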